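(* Let $n>1$ be an integer and let $G$ be a group. The group ring $\mathbb{Z}_nG$ is unit-regular if and only if $n$ is a product of distinct primes and $G$ is a locally finite group in which the order of every element is relatively prime to $n$.
   Context: $\mathbb{Z}_n=\mathbb{Z}/n\mathbb{Z}$. A ring $R$ is unit-regular if for every $a\in R$ there is a unit $u\in R$ with $a=aua$. A group is locally finite if each of its finitely generated subgroups is finite. *)

theory Defs
  imports "HOL-Algebra.Generated_Groups" "HOL-Number_Theory.Residues"
begin

text \<open>The group ring \<open>RG\<close>: finitely supported functions from \<open>G\<close> to \<open>R\<close> under pointwise addition
  and convolution, where \<open>f\<close> stands for the formal sum of the \<open>f(x)\<cdot>x\<close>. Functions are taken
  extensional on \<open>carrier G\<close>, so that each formal sum has exactly one representative. The
  convolution sum ranges over the support of the left factor, which makes it a finite sum.\<close>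

definition group_ring ::
    "('r, 'm) ring_scheme \<Rightarrow> ('g, 'k) monoid_scheme \<Rightarrow> ('g \<Rightarrow> 'r) ring" where
  "group_ring R G =
    \<lparr> carrier = {f \<in> carrier G \<rightarrow>\<^sub>E carrier R. finite {x \<in> carrier G. f x \<noteq> \<zero>\<^bsub>R\<^esub>}},
      monoid.mult = (\<lambda>f h. \<lambda>x\<in>carrier G.
        \<Oplus>\<^bsub>R\<^esub> y \<in> {y \<in> carrier G. f y \<noteq> \<zero>\<^bsub>R\<^esub>}. f y \<otimes>\<^bsub>R\<^esub> h (inv\<^bsub>G\<^esub> y \<otimes>\<^bsub>G\<^esub> x)),
      monoid.one = (\<lambda>x\<in>carrier G. if x = \<one>\<^bsub>G\<^esub> then \<one>\<^bsub>R\<^esub> else \<zero>\<^bsub>R\<^esub>),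
      ring.zero = (\<lambda>x\<in>carrier G. \<zero>\<^bsub>R\<^esub>),
      ring.add = (\<lambda>f h. \<lambda>x\<in>carrier G. f x \<oplus>\<^bsub>R\<^esub> h x) \<rparr>"

locale unit_regular_ring = ring +
  assumes unit_regular: "a \<in> carrier R \<Longrightarrow> \<exists>u\<in>Units R. a = a \<otimes> u \<otimes> a"

locale locally_finite_group = group +
  assumes locally_finite: "\<lbrakk>A \<subseteq> carrier G; finite A\<rbrakk> \<Longrightarrow> finite (generate G A)"

definition product_of_distinct_primes :: "int \<Rightarrow> bool" where
  "product_of_distinct_primes n \<longleftrightarrow> (\<exists>P. finite P \<and> (\<forall>p\<in>P. prime p) \<and> n = \<Prod>P)"

end

theory Submission
  imports Defs "HOL-Algebra.Elementary_Groups" "HOL-Algebra.Subrings" "HOL-Algebra.Sylow"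
    "HOL-Computational_Algebra.Squarefree"
begin

text \<open>Suppose that \<open>RG\<close> is regular. Starting from \<open>e = 1\<close> and passing, one group element \<open>g\<close> at
  a time, from \<open>e\<close> to \<open>(1 - bc)e\<close>, where \<open>b = e - eg\<close> and \<open>b = bcb\<close>, one finds for any finite set
  \<open>A\<close> an element of augmentation 1 that is fixed under right multiplication by \<open>A\<close>. It is constant on
  the left cosets of the subgroup generated by \<open>A\<close>; as its support is finite, that subgroup is
  finite, and its order divides the augmentation 1. The augmentation also makes \<open>R\<close> regular, which
  for the residues modulo \<open>n\<close> means that \<open>n\<close> is squarefree.

  Conversely, the support of \<open>a\<close> generates a finite subgroup \<open>H\<close> of order prime to \<open>n\<close>. The right
  ideal generated by \<open>a\<close> in the group ring of \<open>H\<close> is a direct summand as an abelian group, because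
  the exponent is squarefree, and averaging the projection over \<open>H\<close> as in Maschke's theorem gives
  \<open>b\<close> with \<open>a = aba\<close>. In a finite regular ring the idempotents \<open>ba\<close> and \<open>ab\<close> generate isomorphic
  right ideals; counting corners shows that the complementary idempotents admit nonzero maps between
  them, so that a maximal extension of \<open>a\<close> by partial isomorphisms is invertible.\<close>

section \<open>Finite abelian groups of squarefree exponent\<close>

text \<open>Bezout writes the gcd as an integer combination of the exponents. The exponents that
  carry \<open>x\<close> into \<open>D\<close> can thus be handled like multiples of an order,
  without forming a quotient.\<close>

lemma (in group) pow_gcd_mem_subgroup:
  assumes D: "subgroup D G" and x: "x \<in> carrier G"
    and a: "x [^] (a::nat) \<in> D" and b: "x [^] (b::nat) \<in> D"
  shows "x [^] (gcd a b) \<in> D"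
proof -
  obtain u v where uv: "u * int a + v * int b = gcd (int a) (int b)"
    using bezout_int by blast
  have "(x [^] a) [^] u \<in> D" "(x [^] b) [^] v \<in> D"
    using subgroup_int_pow_closed[OF D] a b by auto
  then have "(x [^] a) [^] u \<otimes> (x [^] b) [^] v \<in> D"
    by (rule subgroup.m_closed[OF D])
  moreover have "(x [^] a) [^] u \<otimes> (x [^] b) [^] v = x [^] (int a * u + int b * v)"
    using x by (simp add: int_pow_mult int_pow_pow flip: int_pow_int)
  moreover have "int a * u + int b * v = int (gcd a b)"
    using uv by (simp add: mult.commute)
  ultimately show ?thesis
    by (simp add: int_pow_int)
qed

lemma (in group) pow_mem_subgroup_cancel:
  assumes D: "subgroup D G" and x: "x \<in> carrier G"
    and "x [^] (a::nat) \<in> D" "x [^] (b::nat) \<in> D" "coprime a b"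
  shows "x \<in> D"
  using pow_gcd_mem_subgroup[OF assms(1-4)] assms(2,5) by simp

text \<open>Let \<open>m\<close> be the least positive exponent that carries \<open>x\<close> into
  \<open>D\<close>, and let the prime \<open>p\<close> divide \<open>m\<close>. Then
  \<open>m\<close> divides \<open>n = p * k\<close>, and squarefreeness keeps \<open>p\<close>,
  hence \<open>m\<close>, from dividing \<open>k\<close>. So \<open>x [^] k\<close> stays outside
  \<open>D\<close>, while its \<open>p\<close>-th power is \<open>\<one>\<close>.\<close>

lemma (in group) exists_prime_root_outside_subgroup:
  assumes D: "subgroup D G" and x: "x \<in> carrier G" "x \<notin> D"
    and n: "squarefree (n::nat)" "x [^] n = \<one>"
  obtains y p where "y \<in> carrier G" "y \<notin> D" "prime (p::nat)" "y [^] p = \<one>"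
proof -
  have n0: "n > 0" using n(1) by (metis gr0I not_squarefree_0)
  define P where "P = (\<lambda>m::nat. m > 0 \<and> x [^] m \<in> D)"
  define m where "m = (LEAST m. P m)"
  have "P n" using n0 n(2) subgroup.one_closed[OF D] by (simp add: P_def)
  then have Pm: "P m" unfolding m_def by (rule LeastI)
  \<comment> \<open>Otherwise the gcd of \<open>m\<close> and \<open>k\<close> would be a smaller
    positive exponent of the same kind.\<close>
  have dvd: "m dvd k" if "x [^] k \<in> D" for k
  proof -
    have "P (gcd m k)"
      using pow_gcd_mem_subgroup[OF D x(1) _ that] Pm by (auto simp: P_def)
    then have "m \<le> gcd m k" unfolding m_def by (rule Least_le)
    moreover have "gcd m k \<le> m" using Pm by (intro gcd_le1_nat) (auto simp: P_def)
    ultimately show ?thesis by (metis gcd_dvd2 le_antisym)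
  qed
  have "m \<noteq> 1" using Pm x by (auto simp: P_def)
  then obtain p where p: "prime p" "p dvd m" by (metis prime_factor_nat)
  have "m dvd n" using dvd n(2) subgroup.one_closed[OF D] by simp
  with p obtain k where k: "n = p * k" by (meson dvd_trans dvdE)
  have "x [^] k \<notin> D"
  proof
    assume "x [^] k \<in> D"
    then have "p dvd k" using dvd p(2) dvd_trans by blast
    then have "p ^ 2 dvd n" by (auto simp: k power2_eq_square)
    with n(1) have "p dvd 1" by (rule squarefreeD)
    with p(1) show False by (simp add: prime_nat_iff)
  qed
  moreover have "(x [^] k) [^] p = \<one>"
    using x n(2) by (simp add: nat_pow_pow k mult.commute)
  ultimately show ?thesis using that[of "x [^] k" p] x p(1) by simp
qed

text \<open>A subgroup \<open>C\<close> maximal among those meeting \<open>B\<close> trivially is a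
  complement. If \<open>D = B <#> C\<close> were proper, an element \<open>y\<close> of prime order
  would lie outside \<open>D\<close>; its cyclic group meets \<open>D\<close> trivially, so
  adjoining it to \<open>C\<close> contradicts maximality.\<close>

lemma (in comm_group) squarefree_exponent_complement:
  assumes fin: "finite (carrier G)" and B: "subgroup B G"
    and n: "squarefree (n::nat)" "\<And>x. x \<in> carrier G \<Longrightarrow> x [^] n = \<one>"
  obtains C where "subgroup C G" "B \<inter> C = {\<one>}" "B <#> C = carrier G"
proof -
  define F where "F = {C. subgroup C G \<and> B \<inter> C = {\<one>}}"
  have "F \<subseteq> Pow (carrier G)" by (auto simp: F_def dest: subgroup.subset)
  then have "finite F" using fin by (meson finite_Pow_iff finite_subset)
  moreover have "{\<one>} \<in> F"
    using B by (auto simp: F_def triv_subgroup subgroup.one_closed)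
  ultimately obtain C where CF: "C \<in> F" and Cmax: "\<And>C'. C' \<in> F \<Longrightarrow> C \<subseteq> C' \<Longrightarrow> C = C'"
    using finite_has_maximal[of F] by blast
  then have C: "subgroup C G" and BC: "B \<inter> C = {\<one>}" by (auto simp: F_def)
  define D where "D = B <#> C"
  have D: "subgroup D G" unfolding D_def by (rule mult_subgroups[OF B C])
  have BD: "B \<subseteq> D"
  proof
    fix b assume b: "b \<in> B"
    have "b \<otimes> \<one> \<in> D" unfolding D_def set_mult_def using b subgroup.one_closed[OF C] by blast
    then show "b \<in> D" using b subgroup.mem_carrier[OF B] by simp
  qed
  have "D = carrier G"
  proof (rule ccontr)
    assume "D \<noteq> carrier G"
    then obtain x where "x \<in> carrier G" "x \<notin> D"
      using subgroup.subset[OF D] by blast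
    then obtain y p where y: "y \<in> carrier G" "y \<notin> D" and p: "prime (p::nat)" "y [^] p = \<one>"
      using exists_prime_root_outside_subgroup[OF D _ _ n(1)] n(2) by metis
    define Y where "Y = generate G {y}"
    have Y: "subgroup Y G" unfolding Y_def using y by (intro generate_is_subgroup) auto
    have "y \<in> Y" unfolding Y_def by (simp add: generate.incl)
    \<comment> \<open>An exponent prime to \<open>p\<close> would by Bezout bring \<open>y\<close>
      itself into \<open>D\<close>. The absolute value appears because that cancellation is stated
      for natural exponents.\<close>
    have YD: "z = \<one>" if "z \<in> Y" "z \<in> D" for z
    proof -
      obtain k :: int where k: "z = y [^] k"
        using \<open>z \<in> Y\<close> y generate_pow[of y] by (auto simp: Y_def)
      have "y [^] nat \<bar>k\<bar> \<in> D"
        using that(2) subgroup.m_inv_closed[OF D that(2)] y(1) unfolding k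
        by (cases "k \<ge> 0") (simp_all add: int_pow_neg)
      then have "\<not> coprime (nat \<bar>k\<bar>) p"
        using pow_mem_subgroup_cancel[OF D y(1)] y p subgroup.one_closed[OF D] by metis
      then have "p dvd nat \<bar>k\<bar>" using p(1)
        using prime_imp_coprime_nat coprime_commute by blast
      then have "int p dvd k" by (simp flip: int_dvd_int_iff)
      then obtain l where "k = int p * l" by (rule dvdE)
      then show ?thesis using y p(2) unfolding k
        by (simp add: int_pow_pow[symmetric] int_pow_int)
    qed
    define C' where "C' = C <#> Y"
    have C': "subgroup C' G" unfolding C'_def by (rule mult_subgroups[OF C Y])
    have "B \<inter> C' = {\<one>}"
    proof -
      \<comment> \<open>From \<open>b = c \<otimes> z\<close> one gets
        \<open>z = b \<otimes> inv c\<close> in \<open>D\<close>, so \<open>z\<close> is trivial and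
        \<open>b = c\<close> lies in both \<open>B\<close> and \<open>C\<close>.\<close>
      have "b = \<one>" if b: "b \<in> B" "b \<in> C'" for b
      proof -
        obtain c z where c: "c \<in> C" "z \<in> Y" "b = c \<otimes> z"
          using b(2) by (auto simp: C'_def set_mult_def)
        note carr = subgroup.mem_carrier[OF B b(1)] subgroup.mem_carrier[OF C c(1)] subgroup.mem_carrier[OF Y c(2)]
        have "z = b \<otimes> inv c"
          using inv_solve_right[of z b c] m_comm[of z c] carr c(3) by simp
        then have "z \<in> D" unfolding D_def set_mult_def
          using b(1) subgroup.m_inv_closed[OF C c(1)] by blast
        then have "b = c" using YD[OF c(2)] c(3) carr(2) by simp
        then show ?thesis using BC b(1) c(1) by blast
      qed
      then show ?thesis using subgroup.one_closed[OF B] subgroup.one_closed[OF C'] by blast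
    qed
    then have "C' \<in> F" using C' by (simp add: F_def)
    moreover have "C \<subseteq> C'"
    proof
      fix c assume c: "c \<in> C"
      have "c \<otimes> \<one> \<in> C'" unfolding C'_def set_mult_def using c subgroup.one_closed[OF Y] by blast
      then show "c \<in> C'" using c subgroup.mem_carrier[OF C] by simp
    qed
    ultimately have "C = C'" by (rule Cmax)
    moreover have "\<one> \<otimes> y \<in> C'"
      unfolding C'_def set_mult_def using \<open>y \<in> Y\<close> subgroup.one_closed[OF C] by blast
    ultimately have "y \<in> C" using y by simp
    then have "\<one> \<otimes> y \<in> D" unfolding D_def set_mult_def using subgroup.one_closed[OF B] by blast
    with y show False by simp
  qed
  with C BC that show ?thesis by (simp add: D_def)
qed

text \<open>The map is the projection along a complement of \<open>B\<close>. Applied to the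
  additive group of a ring and a right ideal \<open>B\<close>, it is the map that will be
  averaged.\<close>

lemma (in comm_group) squarefree_exponent_projection:
  assumes "finite (carrier G)" and B: "subgroup B G"
    and "squarefree (n::nat)" "\<And>x. x \<in> carrier G \<Longrightarrow> x [^] n = \<one>"
  obtains \<pi> where "\<pi> \<in> hom G G" "\<pi> ` carrier G \<subseteq> B" "\<And>b. b \<in> B \<Longrightarrow> \<pi> b = b"
proof -
  obtain C where C: "subgroup C G" "B \<inter> C = {\<one>}" "B <#> C = carrier G"
    using squarefree_exponent_complement[OF assms] by metis
  interpret S: group_disjoint_sum G B C
    using B C(1) by unfold_locales (auto simp: subgroup_def)
  have uniq: "x = x' \<and> y = y'" if "x \<in> B" "y \<in> C" "x' \<in> B" "y' \<in> C" "x \<otimes> y = x' \<otimes> y'" for x y x' y'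
    using S.cancel C(2) that by blast
  define \<pi> where "\<pi> x = (THE b. b \<in> B \<and> (\<exists>c\<in>C. x = b \<otimes> c))" for x
  have \<pi>: "\<pi> (b \<otimes> c) = b" if "b \<in> B" "c \<in> C" for b c
    unfolding \<pi>_def using that uniq by (intro the_equality) blast+
  have split: "\<exists>b\<in>B. \<exists>c\<in>C. x = b \<otimes> c" if "x \<in> carrier G" for x
    using that unfolding C(3)[symmetric] set_mult_def by blast
  note Bc = subgroup.mem_carrier[OF B] and Cc = subgroup.mem_carrier[OF C(1)]
  show ?thesis
  proof
    show "\<pi> ` carrier G \<subseteq> B" using split \<pi> by fastforce
    show "\<pi> b = b" if "b \<in> B" for b
      using \<pi>[OF that subgroup.one_closed[OF C(1)]] Bc[OF that] by simp
    show "\<pi> \<in> hom G G"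
    proof (rule homI)
      fix x y assume "x \<in> carrier G" "y \<in> carrier G"
      then obtain b c b' c' where bc: "b \<in> B" "c \<in> C" "x = b \<otimes> c" "b' \<in> B" "c' \<in> C" "y = b' \<otimes> c'"
        using split by metis
      have "x \<otimes> y = (b \<otimes> b') \<otimes> (c \<otimes> c')"
        using bc Bc Cc by (simp add: m_ac)
      then show "\<pi> (x \<otimes> y) = \<pi> x \<otimes> \<pi> y"
        using bc \<pi> subgroup.m_closed[OF B] subgroup.m_closed[OF C(1)] by metis
    qed (use split \<pi> Bc in fastforce)
  qed
qed

text \<open>Cauchy's theorem, as the case of exponent 1 in Sylow's theorem: a common prime divisor
  \<open>p\<close> of \<open>card H\<close> and \<open>n\<close> would give a subgroup of order
  \<open>p\<close>, whose nontrivial elements have order \<open>p\<close>.\<close>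

lemma (in group) coprime_card_subgroup:
  assumes H: "subgroup H G" "finite H" and cop: "\<And>x. x \<in> H \<Longrightarrow> coprime (ord x) n"
  shows "coprime (card H) n"
proof (rule ccontr)
  assume "\<not> coprime (card H) n"
  then obtain p where p: "prime p" "p dvd card H" "p dvd n"
    by (metis coprime_iff_gcd_eq_1 gcd_nat.bounded_iff prime_factor_nat)
  then obtain m where "card H = p ^ 1 * m" by auto
  then obtain K where K: "subgroup K (G\<lparr>carrier := H\<rparr>)" "card K = p ^ 1"
    using sylow_thm[OF p(1) subgroup_imp_group[OF H(1)], of 1 m] H(2) by (auto simp: Coset.order_def)
  have KG: "subgroup K G" using incl_subgroup[OF H(1) K(1)] .
  have KH: "K \<subseteq> H" using subgroup.subset[OF K(1)] by simp
  have "card K > 1" using K(2) p(1) by (simp add: prime_gt_Suc_0_nat)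
  then have "\<not> K \<subseteq> {\<one>}" using card_mono[of "{\<one>}" K] by auto
  then obtain x where x: "x \<in> K" "x \<noteq> \<one>" by blast
  have xc: "x \<in> carrier G" by (rule subgroup.mem_carrier[OF KG x(1)])
  have "x [^] p = \<one>"
    using group.pow_order_eq_1[OF subgroup_imp_group[OF KG], of x] x(1) K(2)
    by (simp add: Coset.order_def flip: nat_pow_consistent)
  then have "ord x dvd p" using xc by (simp add: pow_eq_id)
  moreover have "ord x \<noteq> 1" using x(2) ord_eq_1[OF xc] by blast
  ultimately have "ord x = p" using p(1) prime_nat_iff by blast
  then have "coprime p n" using cop[of x] x(1) KH by auto
  then show False using p(1,3) coprime_absorb_left not_prime_unit by blast
qed

section \<open>Finite regular rings\<close>

text \<open>For an idempotent \<open>e\<close>, splitting \<open>x\<close> as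
  \<open>xe + (x - xe)\<close> gives \<open>card L = card (C e) * card (K e)\<close>, where
  \<open>L\<close> is a right ideal. Right multiplications by \<open>b\<close> and \<open>a\<close>
  are inverse bijections between \<open>C (b \<otimes> a)\<close> and
  \<open>C (a \<otimes> b)\<close>, so these factors cancel by finiteness. Counting thus replaces a
  cancellation law for modules.\<close>

lemma (in ring) corner_card_complement:
  assumes fin: "finite (carrier R)" and a: "a \<in> carrier R" and b: "b \<in> carrier R"
    and aba: "a \<otimes> b \<otimes> a = a" and bab: "b \<otimes> a \<otimes> b = b" and g: "g \<in> carrier R"
  shows "card {x \<in> carrier R. g \<otimes> x = x \<and> x \<otimes> (b \<otimes> a) = \<zero>}
    = card {x \<in> carrier R. g \<otimes> x = x \<and> x \<otimes> (a \<otimes> b) = \<zero>}"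
proof -
  define L where "L = {x \<in> carrier R. g \<otimes> x = x}"
  define C where "C e = {x \<in> L. x \<otimes> e = x}" for e
  define K where "K e = {x \<in> L. x \<otimes> e = \<zero>}" for e
  have cancel: "x \<oplus> (y \<oplus> \<ominus> x) = y" if "x \<in> carrier R" "y \<in> carrier R" for x y
    using that by (metis a_comm a_inv_closed add.m_closed r_neg1)
  have finL: "finite L" using fin by (simp add: L_def)
  have Lcarr: "x \<in> carrier R" if "x \<in> L" for x using that by (simp add: L_def)
  have Lmult: "x \<otimes> y \<in> L" if "x \<in> L" "y \<in> carrier R" for x y
    using that g by (simp add: L_def m_assoc[symmetric])
  have Ladd: "x \<oplus> y \<in> L" if "x \<in> L" "y \<in> L" for x y
    using that g by (simp add: L_def r_distr)
  have Lneg: "\<ominus> x \<in> L" if "x \<in> L" for x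
    using that g by (simp add: L_def r_minus)
  have "\<zero> \<in> L" using g by (simp add: L_def)
  have split: "card L = card (C e) * card (K e)" if e: "e \<in> carrier R" "e \<otimes> e = e" for e
  proof -
    have "bij_betw (\<lambda>(x, y). x \<oplus> y) (C e \<times> K e) L"
    proof (rule bij_betwI[where g = "\<lambda>x. (x \<otimes> e, x \<oplus> \<ominus> (x \<otimes> e))"])
      show "(\<lambda>(x, y). x \<oplus> y) \<in> C e \<times> K e \<rightarrow> L"
        using Ladd by (auto simp: C_def K_def)
      show "(\<lambda>x. (x \<otimes> e, x \<oplus> \<ominus> (x \<otimes> e))) \<in> L \<rightarrow> C e \<times> K e"
        using e by (auto simp: C_def K_def Ladd Lneg Lmult m_assoc Lcarr l_distr l_minus r_neg)
      show "(\<lambda>x. (x \<otimes> e, x \<oplus> \<ominus> (x \<otimes> e))) (case x of (x, y) \<Rightarrow> x \<oplus> y) = x"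
        if "x \<in> C e \<times> K e" for x
        using that e by (auto simp: C_def K_def l_distr Lcarr a_assoc cancel)
      show "(case (x \<otimes> e, x \<oplus> \<ominus> (x \<otimes> e)) of (x, y) \<Rightarrow> x \<oplus> y) = x" if "x \<in> L" for x
        using that e by (simp add: Lcarr cancel)
    qed
    then show ?thesis using bij_betw_same_card by (metis card_cartesian_product)
  qed
  have "bij_betw (\<lambda>x. x \<otimes> b) (C (b \<otimes> a)) (C (a \<otimes> b))"
  proof (rule bij_betwI[where g = "\<lambda>x. x \<otimes> a"])
    show "(\<lambda>x. x \<otimes> b) \<in> C (b \<otimes> a) \<rightarrow> C (a \<otimes> b)"
      using a b bab by (auto simp: C_def Lmult m_assoc Lcarr)
    show "(\<lambda>x. x \<otimes> a) \<in> C (a \<otimes> b) \<rightarrow> C (b \<otimes> a)"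
      using a b aba by (auto simp: C_def Lmult m_assoc Lcarr)
  qed (use a b in \<open>auto simp: C_def m_assoc Lcarr\<close>)
  then have "card (C (b \<otimes> a)) = card (C (a \<otimes> b))" by (rule bij_betw_same_card)
  moreover have "card L = card (C (b \<otimes> a)) * card (K (b \<otimes> a))"
    using a b bab aba by (intro split) (simp_all add: m_assoc)
  moreover have "card L = card (C (a \<otimes> b)) * card (K (a \<otimes> b))"
    using a b bab aba by (intro split) (simp_all add: m_assoc)
  moreover have "card L > 0" using finL \<open>\<zero> \<in> L\<close> by (auto simp: card_gt_0_iff)
  ultimately have "card (K (b \<otimes> a)) = card (K (a \<otimes> b))" by simp
  then show ?thesis by (simp add: K_def L_def conj_assoc)
qed

text \<open>Extend \<open>a\<close> to a maximal pair \<open>(c, d)\<close> of mutually inverse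
  partial isomorphisms. The complementary idempotents \<open>g = 1 - dc\<close> and
  \<open>h = 1 - cd\<close> then vanish, so \<open>d\<close> is a unit, and \<open>da = ba\<close>
  gives \<open>ada = a\<close>.\<close>

lemma (in ring) finite_regular_imp_unit_regular:
  assumes fin: "finite (carrier R)"
    and reg: "\<And>a. a \<in> carrier R \<Longrightarrow> \<exists>b\<in>carrier R. a = a \<otimes> b \<otimes> a"
    and a: "a \<in> carrier R"
  shows "\<exists>u\<in>Units R. a = a \<otimes> u \<otimes> a"
proof -
  have reflexive_inverse: "\<exists>b\<in>carrier R. a \<otimes> b \<otimes> a = a \<and> b \<otimes> a \<otimes> b = b"
    if a: "a \<in> carrier R" for a
  proof -
    obtain c where c: "c \<in> carrier R" "a \<otimes> c \<otimes> a = a" using reg[OF a] by metis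
    then have *: "a \<otimes> (c \<otimes> a) = a" using a by (simp add: m_assoc)
    have **: "a \<otimes> (c \<otimes> (a \<otimes> z)) = a \<otimes> z" if "z \<in> carrier R" for z
      using c a that by (simp flip: m_assoc)
    show ?thesis
      \<comment> \<open>Passing from \<open>c\<close> to \<open>cac\<close> keeps the first identity
        and gains the second.\<close>
      using a c * ** by (intro bexI[of _ "c \<otimes> a \<otimes> c"]) (auto simp: m_assoc)
  qed
  obtain b where b: "b \<in> carrier R" "a \<otimes> b \<otimes> a = a" "b \<otimes> a \<otimes> b = b"
    using reflexive_inverse[OF a] by blast
  \<comment> \<open>The pair \<open>(c, d)\<close> extends \<open>(a, b)\<close>; by the last two conditions \<open>a \<otimes> d \<otimes> a = a\<close> persists.\<close>
  define P where "P = (\<lambda>(c, d). c \<in> carrier R \<and> d \<in> carrier R \<and> c \<otimes> d \<otimes> c = c \<and> d \<otimes> c \<otimes> d = d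
    \<and> c \<otimes> (b \<otimes> a) = a \<and> d \<otimes> a = b \<otimes> a)"
  \<comment> \<open>For pairs satisfying \<open>P\<close> this is the right ideal generated by the
    idempotent \<open>dc\<close>; its cardinality measures the size of the extension.\<close>
  define I where "I = (\<lambda>(c, d). {z \<in> carrier R. d \<otimes> c \<otimes> z = z})"
  have "P (a, b)" using a b by (simp add: P_def m_assoc)
  moreover have "(card \<circ> I) v < Suc (card (carrier R))" for v
    using fin by (auto simp: I_def less_Suc_eq_le split: prod.split intro!: card_mono)
  ultimately obtain w where w: "P w" "\<And>v. P v \<Longrightarrow> card (I v) \<le> card (I w)"
    using ex_has_greatest_nat[of P "(a, b)" "card \<circ> I" "Suc (card (carrier R))"] by auto
  obtain c d where cd: "w = (c, d)" by force
  have c: "c \<in> carrier R" and d: "d \<in> carrier R"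
    and cdc: "c \<otimes> d \<otimes> c = c" and dcd: "d \<otimes> c \<otimes> d = d"
    and ca: "c \<otimes> (b \<otimes> a) = a" and da: "d \<otimes> a = b \<otimes> a"
    using w(1) by (auto simp: P_def cd)
  define g where "g = \<one> \<ominus> d \<otimes> c"
  define h where "h = \<one> \<ominus> c \<otimes> d"
  have g: "g \<in> carrier R" and h: "h \<in> carrier R" using c d by (auto simp: g_def h_def)
  have dist: "(\<one> \<ominus> x) \<otimes> z = z \<ominus> x \<otimes> z" "z \<otimes> (\<one> \<ominus> x) = z \<ominus> z \<otimes> x"
    if "x \<in> carrier R" "z \<in> carrier R" for x z
    using that by (auto simp: minus_eq l_distr r_distr l_minus r_minus)
  have gd: "g \<otimes> d = \<zero>" and cg: "c \<otimes> g = \<zero>" and hc: "h \<otimes> c = \<zero>" and dh: "d \<otimes> h = \<zero>"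
    using c d cdc dcd by (simp_all add: g_def h_def dist m_assoc r_right_minus_eq)
  have gdc: "g \<otimes> (d \<otimes> c) = \<zero>" and hcd: "h \<otimes> (c \<otimes> d) = \<zero>"
    using g h c d gd hc by (simp_all flip: m_assoc)
  then have gg: "g \<otimes> g = g" and hh: "h \<otimes> h = h"
    using g h c d by (simp_all add: g_def h_def dist) (simp_all add: minus_eq r_neg)
  have eq_one: "x = \<one>" if "\<one> \<ominus> x = \<zero>" "x \<in> carrier R" for x
    using that by (metis one_closed r_right_minus_eq)
  \<comment> \<open>\<open>A\<close> has at least the two elements \<open>s\<close> and zero, so
    \<open>B\<close>, being equally large, cannot consist of zero alone.\<close>
  have nontrivial: "\<exists>x\<in>B. x \<noteq> \<zero>" if "card A = card B" "finite A" "s \<in> A" "s \<noteq> \<zero>" "\<zero> \<in> A" for A B s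
  proof (rule ccontr)
    assume "\<not> ?thesis"
    then have "B \<subseteq> {\<zero>}" by auto
    then have "card B \<le> 1" using card_mono[of "{\<zero>}" B] by simp
    moreover have "card {s, \<zero>} \<le> card A" using that by (intro card_mono) auto
    ultimately show False using that by simp
  qed
  have "g = \<zero>"
  proof (rule ccontr)
    assume "g \<noteq> \<zero>"
    \<comment> \<open>\<open>g\<close> itself is a nonzero element of the corner
      \<open>gR(1 - dc)\<close>; by the count, the corner \<open>gR(1 - cd)\<close> is nonzero
      too.\<close>
    have "\<exists>x\<in>{x \<in> carrier R. g \<otimes> x = x \<and> x \<otimes> (c \<otimes> d) = \<zero>}. x \<noteq> \<zero>"
      by (rule nontrivial[OF corner_card_complement[OF fin c d cdc dcd g]])
        (use g gg gdc \<open>g \<noteq> \<zero>\<close> c d fin in auto)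
    then obtain x where x: "x \<in> carrier R" "g \<otimes> x = x" "x \<otimes> (c \<otimes> d) = \<zero>" "x \<noteq> \<zero>" by blast
    then have xh: "x \<otimes> h = x" using c d by (simp add: h_def dist) (simp add: minus_eq)
    obtain y0 where y0: "y0 \<in> carrier R" "x \<otimes> y0 \<otimes> x = x" "y0 \<otimes> x \<otimes> y0 = y0"
      using reflexive_inverse[OF x(1)] by blast
    \<comment> \<open>The inverse of \<open>x\<close> is cut down to \<open>hRg\<close>, while
      \<open>x\<close> lies in \<open>gRh\<close>. Hence \<open>cx\<close>, \<open>xc\<close>,
      \<open>dy\<close> and \<open>yd\<close> vanish, and \<open>x\<close> and \<open>y\<close> are
      still inverse to each other in the sense of \<open>xyx = x\<close> and
      \<open>yxy = y\<close>.\<close>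
    define y where "y = h \<otimes> y0 \<otimes> g"
    have y: "y \<in> carrier R" using y0 g h by (simp add: y_def)
    have hy: "h \<otimes> y = y" using h g y0 hh by (simp add: y_def m_assoc[symmetric])
    have yg: "y \<otimes> g = y" using h g y0 gg by (simp add: y_def m_assoc)
    have xy: "x \<otimes> y = x \<otimes> y0 \<otimes> g" using x xh h g y0 by (simp add: y_def m_assoc[symmetric])
    have xyx: "x \<otimes> y \<otimes> x = x" using x y0 g by (simp add: xy) (simp add: m_assoc)
    have "y \<otimes> (x \<otimes> y) = h \<otimes> (y0 \<otimes> (g \<otimes> x) \<otimes> y0) \<otimes> g"
      unfolding xy unfolding y_def using x(1) y0(1) g h by (simp add: m_assoc)
    then have yxy: "y \<otimes> x \<otimes> y = y" using x y y0 by (simp add: y_def[symmetric] m_assoc[of y])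
    have cx: "c \<otimes> x = \<zero>" using m_assoc[of c g x] c g x cg by simp
    have xc: "x \<otimes> c = \<zero>" using m_assoc[of x h c] c h x xh hc by simp
    have dy: "d \<otimes> y = \<zero>" using m_assoc[of d h y] d h y hy dh by simp
    have yd: "y \<otimes> d = \<zero>" using m_assoc[of y g d] d g y yg gd by simp
    have z1: "(c \<oplus> y) \<otimes> (d \<oplus> x) = c \<otimes> d \<oplus> y \<otimes> x"
      using c d x y cx yd by (simp add: l_distr r_distr)
    have z2: "(d \<oplus> x) \<otimes> (c \<oplus> y) = d \<otimes> c \<oplus> x \<otimes> y"
      using c d x y dy xc by (simp add: l_distr r_distr)
    have z3: "c \<otimes> d \<otimes> y = \<zero>" "y \<otimes> x \<otimes> c = \<zero>" "d \<otimes> c \<otimes> x = \<zero>" "x \<otimes> y \<otimes> d = \<zero>"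
      using c d x y cx xc dy yd by (simp_all add: m_assoc)
    have "P (c \<oplus> y, d \<oplus> x)"
      unfolding P_def prod.case
    proof (intro conjI)
      show "(c \<oplus> y) \<otimes> (d \<oplus> x) \<otimes> (c \<oplus> y) = c \<oplus> y"
        unfolding z1 using c d x y z3 cdc yxy by (simp add: l_distr r_distr)
      show "(d \<oplus> x) \<otimes> (c \<oplus> y) \<otimes> (d \<oplus> x) = d \<oplus> x"
        unfolding z2 using c d x y z3 dcd xyx by (simp add: l_distr r_distr)
      \<comment> \<open>The new parts do not disturb the conditions on \<open>a\<close>:
        \<open>yba = yda = 0\<close>, and below \<open>xa = xcba = 0\<close>.\<close>
      have "y \<otimes> (b \<otimes> a) = y \<otimes> d \<otimes> a" using da y d a by (simp add: m_assoc)
      then show "(c \<oplus> y) \<otimes> (b \<otimes> a) = a" using c y a b ca yd by (simp add: l_distr)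
      have "x \<otimes> a = x \<otimes> c \<otimes> (b \<otimes> a)" using ca x c a b by (simp add: m_assoc)
      then show "(d \<oplus> x) \<otimes> a = b \<otimes> a" using d x a b da xc by (simp add: l_distr)
    qed (use c d x y in auto)
    then have "card (I (c \<oplus> y, d \<oplus> x)) \<le> card (I w)" by (rule w(2))
    \<comment> \<open>What \<open>dc\<close> fixes is killed by \<open>xy\<close>, hence remains
      fixed by the sum. The inclusion is strict at \<open>x\<close>, which \<open>dc\<close> kills
      and \<open>xy\<close> fixes.\<close>
    moreover have "I w \<subset> I (c \<oplus> y, d \<oplus> x)"
    proof
      show "I w \<subseteq> I (c \<oplus> y, d \<oplus> x)"
      proof
        fix z assume "z \<in> I w"
        then have z: "z \<in> carrier R" "d \<otimes> c \<otimes> z = z" by (auto simp: I_def cd)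
        have "x \<otimes> y \<otimes> (d \<otimes> c \<otimes> z) = x \<otimes> y \<otimes> d \<otimes> (c \<otimes> z)"
          using x y d c z(1) by (simp add: m_assoc)
        then have "x \<otimes> y \<otimes> z = \<zero>" using z z3 c by simp
        then show "z \<in> I (c \<oplus> y, d \<oplus> x)" using z x y c d by (simp add: I_def z2 l_distr)
      qed
      have "x \<in> I (c \<oplus> y, d \<oplus> x)" "x \<notin> I w"
        using x y c d z3 xyx by (auto simp: I_def cd z2 l_distr)
      then show "I w \<noteq> I (c \<oplus> y, d \<oplus> x)" by blast
    qed
    moreover have "finite (I (c \<oplus> y, d \<oplus> x))" using fin by (simp add: I_def)
    ultimately show False using psubset_card_mono by (meson leD)
  qed
  then have dc1: "d \<otimes> c = \<one>" using c d by (auto simp: g_def intro: eq_one)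
  have "h = \<zero>"
  proof (rule ccontr)
    assume "h \<noteq> \<zero>"
    \<comment> \<open>The count makes this corner as large as \<open>hR(1 - cd)\<close>, which
      contains \<open>h\<close>; but \<open>dc = 1\<close> leaves only zero in it.\<close>
    have "\<exists>x\<in>{x \<in> carrier R. h \<otimes> x = x \<and> x \<otimes> (d \<otimes> c) = \<zero>}. x \<noteq> \<zero>"
      by (rule nontrivial[OF corner_card_complement[OF fin d c dcd cdc h]])
        (use h hh hcd \<open>h \<noteq> \<zero>\<close> c d fin in auto)
    then show False using dc1 by auto
  qed
  then have "c \<otimes> d = \<one>" using c d by (auto simp: h_def intro: eq_one)
  then have "d \<in> Units R" using c d dc1 by (auto simp: Units_def)
  moreover have "a = a \<otimes> d \<otimes> a" using a b d da by (simp add: m_assoc)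
  ultimately show ?thesis by blast
qed

section \<open>Averaging\<close>

text \<open>Maschke's argument for the right ideal \<open>B = aR\<close>. The average of an additive
  projection onto \<open>B\<close> respects right multiplication by \<open>H\<close>; as
  \<open>H\<close> spans \<open>R\<close> additively, it is left multiplication by
  \<open>s = avg \<one>\<close>, an element \<open>ac\<close> of \<open>B\<close>. It multiplies
  \<open>a\<close> by \<open>card H\<close>, which is invertible modulo \<open>n\<close>.\<close>

lemma (in ring) averaging_imp_regular:
  assumes fin: "finite (carrier R)" and n: "squarefree (n::nat)" "[n] \<cdot> \<one> = \<zero>"
    and H: "subgroup H (units_of R)" "coprime (card H) n"
    and span: "\<And>A. additive_subgroup A R \<Longrightarrow> H \<subseteq> A \<Longrightarrow> carrier R \<subseteq> A"
    and a: "a \<in> carrier R"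
  shows "\<exists>b\<in>carrier R. a = a \<otimes> b \<otimes> a"
proof -
  have Hc: "h \<in> carrier R" if "h \<in> H" for h
    using subgroup.subset[OF H(1)] that by (auto simp: units_of_carrier)
  have HU: "h \<in> Units R" if "h \<in> H" for h
    using subgroup.subset[OF H(1)] that by (auto simp: units_of_carrier)
  have finH: "finite H" using Hc fin by (meson finite_subset subsetI)
  have Hm: "h \<otimes> k \<in> H" if "h \<in> H" "k \<in> H" for h k
    using subgroup.m_closed[OF H(1) that] by (simp add: units_of_mult)
  have Hi: "inv h \<in> H" if "h \<in> H" for h
    using subgroup.m_inv_closed[OF H(1) that] HU[OF that] by (simp add: units_of_inv)
  have inv_mult_H: "inv (h \<otimes> k) = inv k \<otimes> inv h" if "h \<in> H" "k \<in> H" for h k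
    using group.inv_mult_group[OF units_group, of h k] that HU Hm
    by (simp add: units_of_carrier units_of_mult units_of_inv)
  have n0: "[n] \<cdot> x = \<zero>" if "x \<in> carrier R" for x
    using add_pow_ldistr[of \<one> x n] n(2) that by simp
  define B where "B = (\<lambda>x. a \<otimes> x) ` carrier R"
  have Bi: "a \<otimes> x \<in> B" if "x \<in> carrier R" for x using that by (auto simp: B_def)
  have Bc: "x \<in> carrier R" if "x \<in> B" for x using that a by (auto simp: B_def)
  have Br: "x \<otimes> y \<in> B" if "x \<in> B" "y \<in> carrier R" for x y
    using that a by (auto simp: B_def m_assoc)
  have B: "subgroup B (add_monoid R)"
  proof (rule add.subgroupI)
    show "x \<oplus> y \<in> B" if "x \<in> B" "y \<in> B" for x y
      using that a Bi by (auto simp: B_def r_distr[symmetric])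
    show "\<ominus> x \<in> B" if "x \<in> B" for x
      using that a Bi by (auto simp: B_def r_minus[symmetric])
  qed (use Bc in \<open>auto simp: B_def\<close>)
  obtain \<pi> where hom: "\<pi> \<in> hom (add_monoid R) (add_monoid R)" and \<pi>B: "\<pi> ` carrier R \<subseteq> B"
    and \<pi>id: "\<And>b. b \<in> B \<Longrightarrow> \<pi> b = b"
    using comm_group.squarefree_exponent_projection[OF a_comm_group, of B n] fin B n(1) n0
    by (auto simp: add_pow_def)
  interpret \<pi>: abelian_group_hom R R \<pi>
    using hom by unfold_locales
  have \<pi>B': "\<pi> x \<in> B" if "x \<in> carrier R" for x using that \<pi>B by blast
  \<comment> \<open>The average is not normalized; the inverse of \<open>card H\<close> modulo
    \<open>n\<close> enters only at the end, as \<open>k\<close>.\<close>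
  define avg where "avg x = (\<Oplus>h\<in>H. \<pi> (x \<otimes> inv h) \<otimes> h)" for x
  have term_c: "\<pi> (x \<otimes> inv h) \<otimes> h \<in> carrier R" if "x \<in> carrier R" "h \<in> H" for x h
    using that Hc Hi by simp
  have avg_c: "avg x \<in> carrier R" if "x \<in> carrier R" for x
    unfolding avg_def using that term_c by (intro finsum_closed) auto
  have avg_B: "avg x \<in> B" if "x \<in> carrier R" for x
  proof -
    have "(\<Oplus>h\<in>K. \<pi> (x \<otimes> inv h) \<otimes> h) \<in> B" if "K \<subseteq> H" for K
      using finite_subset[OF that finH] that
    proof (induction K)
      case empty
      show ?case using subgroup.one_closed[OF B] by simp
    next
      case (insert h K)
      then have "h \<in> H" "K \<subseteq> H" by auto
      then show ?case
        using insert term_c[OF \<open>x \<in> carrier R\<close>] subgroup.m_closed[OF B] \<pi>B' Hc Hi Br \<open>x \<in> carrier R\<close>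
        by (subst finsum_insert) auto
    qed
    then show ?thesis by (simp add: avg_def)
  qed
  have avg_zero: "avg \<zero> = \<zero>"
    unfolding avg_def using Hc Hi by (intro add.finprod_one_eqI) simp
  have avg_add: "avg (x \<oplus> y) = avg x \<oplus> avg y" if "x \<in> carrier R" "y \<in> carrier R" for x y
  proof -
    have "avg (x \<oplus> y) = (\<Oplus>h\<in>H. \<pi> (x \<otimes> inv h) \<otimes> h \<oplus> \<pi> (y \<otimes> inv h) \<otimes> h)"
      unfolding avg_def using that Hc Hi by (intro finsum_cong') (auto simp: l_distr)
    then show ?thesis
      unfolding avg_def using that term_c by (simp add: finsum_addf)
  qed
  have avg_right: "avg (x \<otimes> k) = avg x \<otimes> k" if x: "x \<in> carrier R" and k: "k \<in> H" for x k
  proof -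
    have bij: "(\<lambda>h. h \<otimes> k) ` H = H"
    proof
      show "H \<subseteq> (\<lambda>h. h \<otimes> k) ` H"
      proof
        fix h assume h: "h \<in> H"
        have "h = h \<otimes> inv k \<otimes> k" using h k Hc HU Hi by (simp add: m_assoc)
        then show "h \<in> (\<lambda>h. h \<otimes> k) ` H" using Hm[OF h Hi[OF k]] by blast
      qed
    qed (use Hm k in auto)
    have inj: "inj_on (\<lambda>h. h \<otimes> k) H"
      using finH bij by (simp add: eq_card_imp_inj_on)
    have "avg (x \<otimes> k) = (\<Oplus>h\<in>(\<lambda>h. h \<otimes> k) ` H. \<pi> (x \<otimes> k \<otimes> inv h) \<otimes> h)"
      unfolding avg_def bij ..
    \<comment> \<open>Substituting \<open>h \<otimes> k\<close> for \<open>h\<close> cancels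
      \<open>k\<close> inside \<open>\<pi>\<close> and leaves a factor \<open>k\<close> on the
      right.\<close>
    also have "\<dots> = (\<Oplus>h\<in>H. \<pi> (x \<otimes> k \<otimes> inv (h \<otimes> k)) \<otimes> (h \<otimes> k))"
      using inj x k Hc Hi Hm bij by (intro finsum_reindex) auto
    also have "\<dots> = (\<Oplus>h\<in>H. \<pi> (x \<otimes> inv h) \<otimes> h \<otimes> k)"
    proof (intro finsum_cong')
      fix h assume h: "h \<in> H"
      have "x \<otimes> k \<otimes> inv (h \<otimes> k) = x \<otimes> (k \<otimes> inv k) \<otimes> inv h"
        using x h k Hc HU Hi by (simp add: inv_mult_H m_assoc del: Units_r_inv)
      then have "x \<otimes> k \<otimes> inv (h \<otimes> k) = x \<otimes> inv h"
        using x k HU by simp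
      then show "\<pi> (x \<otimes> k \<otimes> inv (h \<otimes> k)) \<otimes> (h \<otimes> k) = \<pi> (x \<otimes> inv h) \<otimes> h \<otimes> k"
        using x h k Hc Hi by (simp add: m_assoc)
    qed (use x k Hc Hi in auto)
    also have "\<dots> = avg x \<otimes> k"
      unfolding avg_def using x k Hc term_c finH by (subst finsum_ldistr) auto
    finally show ?thesis .
  qed
  define s where "s = avg \<one>"
  have s: "s \<in> carrier R" by (simp add: s_def avg_c)
  \<comment> \<open>The elements on which \<open>avg\<close> is left multiplication by
    \<open>s\<close> form an additive subgroup containing \<open>H\<close>, to which
    \<open>span\<close> applies.\<close>
  define A where "A = {r \<in> carrier R. avg r = s \<otimes> r}"
  have "additive_subgroup A R"
  proof (rule additive_subgroupI, rule add.subgroupI)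
    show "A \<noteq> {}" using avg_zero s by (auto simp: A_def)
    show "x \<oplus> y \<in> A" if "x \<in> A" "y \<in> A" for x y
      using that s by (auto simp: A_def avg_add r_distr)
    show "\<ominus> x \<in> A" if "x \<in> A" for x
    proof -
      have x: "x \<in> carrier R" "avg x = s \<otimes> x" using that by (auto simp: A_def)
      have "avg x \<oplus> avg (\<ominus> x) = \<zero>"
        using avg_add[of x "\<ominus> x"] x(1) avg_zero by (simp add: r_neg)
      then have "avg (\<ominus> x) = \<ominus> avg x"
        using x(1) avg_c by (metis a_inv_closed minus_equality a_comm)
      then show ?thesis using x s by (simp add: A_def r_minus)
    qed
  qed (auto simp: A_def)
  moreover have "H \<subseteq> A" using Hc avg_right[of \<one>] by (auto simp: A_def s_def)
  ultimately have "a \<in> A" using span a by blast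
  then have "s \<otimes> a = avg a" by (simp add: A_def)
  also have "\<dots> = (\<Oplus>h\<in>H. a)"
    unfolding avg_def
  proof (rule finsum_cong')
    fix h assume h: "h \<in> H"
    \<comment> \<open>As \<open>a \<otimes> inv h\<close> already lies in \<open>B\<close>, the
      projection fixes it, and every term of the average equals \<open>a\<close>.\<close>
    have "\<pi> (a \<otimes> inv h) = a \<otimes> inv h" using h Hc Hi by (intro \<pi>id Bi) auto
    then show "\<pi> (a \<otimes> inv h) \<otimes> h = a" using a h Hc Hi HU by (simp add: m_assoc)
  qed (use a in auto)
  also have "\<dots> = [card H] \<cdot> a" using a by (rule add.finprod_const)
  finally have sa: "s \<otimes> a = [card H] \<cdot> a" .
  obtain c where c: "c \<in> carrier R" "s = a \<otimes> c"
    using avg_B[of \<one>] by (auto simp: B_def s_def)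
  obtain k where k: "[k * card H = 1] (mod n)"
    using H(2) cong_solve_coprime_nat by (metis mult.commute One_nat_def)
  have "[(k * card H)] \<cdot> a = a"
  proof -
    \<comment> \<open>Since \<open>n\<close> annihilates \<open>R\<close>, a multiple of
      \<open>a\<close> depends only on the multiplier modulo \<open>n\<close>.\<close>
    have "[i] \<cdot> a = [(i mod n)] \<cdot> a" for i :: nat
    proof -
      have "[i] \<cdot> a = [(n * (i div n))] \<cdot> a \<oplus> [(i mod n)] \<cdot> a"
        using a by (simp add: add.nat_pow_mult)
      also have "[(n * (i div n))] \<cdot> a = \<zero>"
        using a n0[OF a] by (simp flip: add.nat_pow_pow)
      finally show ?thesis using a by simp
    qed
    then have "[(k * card H)] \<cdot> a = [(1::nat)] \<cdot> a" using k by (metis cong_def)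
    then show ?thesis using a by simp
  qed
  moreover have "a \<otimes> ([k] \<cdot> c) \<otimes> a = [(k * card H)] \<cdot> a"
    using a c s sa by (simp add: add_pow_ldistr add_pow_rdistr add.nat_pow_pow mult.commute)
  ultimately show ?thesis using c(1) by (intro bexI[of _ "[k] \<cdot> c"]) auto
qed

section \<open>The group ring\<close>

lemma (in abelian_monoid) finsum_swap:
  assumes "finite A" "finite B" and f: "\<And>x y. x \<in> A \<Longrightarrow> y \<in> B \<Longrightarrow> f x y \<in> carrier G"
  shows "(\<Oplus>x\<in>A. \<Oplus>y\<in>B. f x y) = (\<Oplus>y\<in>B. \<Oplus>x\<in>A. f x y)"
  using assms(1) f
proof (induction A)
  case empty
  then show ?case by (simp add: add.finprod_one_eqI)
next
  case (insert a A)
  have "(\<Oplus>y\<in>B. \<Oplus>x\<in>insert a A. f x y) = (\<Oplus>y\<in>B. f a y \<oplus> (\<Oplus>x\<in>A. f x y))"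
    using insert by (intro finsum_cong') (auto simp: Pi_def)
  also have "\<dots> = (\<Oplus>y\<in>B. f a y) \<oplus> (\<Oplus>y\<in>B. \<Oplus>x\<in>A. f x y)"
    using insert by (intro finsum_addf) (auto simp: Pi_def)
  finally show ?case using insert by (subst finsum_insert) (auto simp: Pi_def)
qed

definition supp :: "('r, 'm) ring_scheme \<Rightarrow> ('g, 'k) monoid_scheme \<Rightarrow> ('g \<Rightarrow> 'r) \<Rightarrow> 'g set" where
  "supp R G f = {x \<in> carrier G. f x \<noteq> \<zero>\<^bsub>R\<^esub>}"

locale group_and_ring = G: group G + R: ring R
  for G :: "('g, 'k) monoid_scheme" (structure) and R :: "('r, 'm) ring_scheme" (structure)
begin

abbreviation S where "S \<equiv> group_ring R G"

abbreviation spt where "spt \<equiv> supp R G"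

lemma spt_subset: "spt f \<subseteq> carrier G"
  by (auto simp: supp_def)

lemma mem_sptI: "x \<in> carrier G \<Longrightarrow> f x \<noteq> \<zero>\<^bsub>R\<^esub> \<Longrightarrow> x \<in> spt f"
  by (simp add: supp_def)

lemma group_ring_carrier: "f \<in> carrier S \<longleftrightarrow> f \<in> carrier G \<rightarrow>\<^sub>E carrier R \<and> finite (spt f)"
  by (simp add: group_ring_def supp_def)

lemma group_ring_closed [simp]: "f \<in> carrier S \<Longrightarrow> x \<in> carrier G \<Longrightarrow> f x \<in> carrier R"
  by (auto simp: group_ring_carrier)

lemma finite_spt: "f \<in> carrier S \<Longrightarrow> finite (spt f)"
  by (simp add: group_ring_carrier)

lemma group_ring_eqI:
  "f \<in> carrier S \<Longrightarrow> h \<in> carrier S \<Longrightarrow> (\<And>x. x \<in> carrier G \<Longrightarrow> f x = h x) \<Longrightarrow> f = h"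
  by (auto simp: group_ring_carrier intro: PiE_ext)

lemma group_ring_memI:
  assumes "f \<in> extensional (carrier G)" "\<And>x. x \<in> carrier G \<Longrightarrow> f x \<in> carrier R"
    and "finite F" "\<And>x. x \<in> carrier G \<Longrightarrow> x \<notin> F \<Longrightarrow> f x = \<zero>\<^bsub>R\<^esub>"
  shows "f \<in> carrier S"
proof -
  have "spt f \<subseteq> F" using assms(4) by (auto simp: supp_def)
  then have "finite (spt f)" using assms(3) by (rule finite_subset)
  then show ?thesis using assms(1,2) by (auto simp: group_ring_carrier PiE_iff)
qed

lemma group_ring_zero [simp]: "x \<in> carrier G \<Longrightarrow> \<zero>\<^bsub>S\<^esub> x = \<zero>\<^bsub>R\<^esub>"
  and group_ring_one: "x \<in> carrier G \<Longrightarrow> \<one>\<^bsub>S\<^esub> x = (if x = \<one> then \<one>\<^bsub>R\<^esub> else \<zero>\<^bsub>R\<^esub>)"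
  and group_ring_add [simp]: "x \<in> carrier G \<Longrightarrow> (f \<oplus>\<^bsub>S\<^esub> h) x = f x \<oplus>\<^bsub>R\<^esub> h x"
  by (simp_all add: group_ring_def)

text \<open>Enlarging the index set beyond the support only adds zero terms. The free choice of
  \<open>F\<close> lets several products be summed over a common index set.\<close>

lemma group_ring_mult:
  assumes f: "f \<in> carrier S" and h: "h \<in> carrier S" and x: "x \<in> carrier G"
    and F: "finite F" "spt f \<subseteq> F" "F \<subseteq> carrier G"
  shows "(f \<otimes>\<^bsub>S\<^esub> h) x = (\<Oplus>\<^bsub>R\<^esub>y\<in>F. f y \<otimes>\<^bsub>R\<^esub> h (inv y \<otimes> x))"
proof -
  have "(f \<otimes>\<^bsub>S\<^esub> h) x = (\<Oplus>\<^bsub>R\<^esub>y\<in>spt f. f y \<otimes>\<^bsub>R\<^esub> h (inv y \<otimes> x))"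
    using x by (simp add: group_ring_def supp_def)
  also have "\<dots> = (\<Oplus>\<^bsub>R\<^esub>y\<in>F. f y \<otimes>\<^bsub>R\<^esub> h (inv y \<otimes> x))"
    using F f h x by (intro R.add.finprod_mono_neutral_cong_left) (auto simp: supp_def subset_iff)
  finally show ?thesis .
qed

lemma group_ring_zero_closed: "\<zero>\<^bsub>S\<^esub> \<in> carrier S"
  by (rule group_ring_memI[of _ "{}"]) (simp_all, simp add: group_ring_def)

lemma group_ring_one_closed: "\<one>\<^bsub>S\<^esub> \<in> carrier S"
  by (rule group_ring_memI[of _ "{\<one>}"]) (simp_all add: group_ring_one, simp add: group_ring_def)

lemma group_ring_add_closed:
  assumes "f \<in> carrier S" "h \<in> carrier S"
  shows "f \<oplus>\<^bsub>S\<^esub> h \<in> carrier S"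
proof (rule group_ring_memI)
  show "finite (spt f \<union> spt h)" using assms by (simp add: finite_spt)
  show "f \<oplus>\<^bsub>S\<^esub> h \<in> extensional (carrier G)" by (simp add: group_ring_def)
qed (use assms in \<open>auto simp: supp_def\<close>)

lemma spt_mult_subset:
  assumes "f \<in> carrier S" "h \<in> carrier S"
  shows "spt (f \<otimes>\<^bsub>S\<^esub> h) \<subseteq> (\<lambda>(x, y). x \<otimes> y) ` (spt f \<times> spt h)"
proof
  fix x assume "x \<in> spt (f \<otimes>\<^bsub>S\<^esub> h)"
  then have x: "x \<in> carrier G" "(f \<otimes>\<^bsub>S\<^esub> h) x \<noteq> \<zero>\<^bsub>R\<^esub>" by (auto simp: supp_def)
  have "(f \<otimes>\<^bsub>S\<^esub> h) x = (\<Oplus>\<^bsub>R\<^esub>y\<in>spt f. f y \<otimes>\<^bsub>R\<^esub> h (inv y \<otimes> x))"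
    using assms x finite_spt spt_subset by (intro group_ring_mult) auto
  then obtain y where y: "y \<in> spt f" "f y \<otimes>\<^bsub>R\<^esub> h (inv y \<otimes> x) \<noteq> \<zero>\<^bsub>R\<^esub>"
    using x(2) R.add.finprod_one_eqI[of "spt f" "\<lambda>y. f y \<otimes>\<^bsub>R\<^esub> h (inv y \<otimes> x)"] by auto
  then have yc: "y \<in> carrier G" using spt_subset by blast
  have "inv y \<otimes> x \<in> spt h"
    using y yc x(1) assms by (intro mem_sptI) auto
  moreover have "x = y \<otimes> (inv y \<otimes> x)" using yc x(1) by (simp add: G.m_assoc[symmetric])
  ultimately show "x \<in> (\<lambda>(x, y). x \<otimes> y) ` (spt f \<times> spt h)"
    using y(1) by (intro image_eqI[of _ _ "(y, inv y \<otimes> x)"]) auto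
qed

lemma group_ring_mult_closed:
  assumes "f \<in> carrier S" "h \<in> carrier S"
  shows "f \<otimes>\<^bsub>S\<^esub> h \<in> carrier S"
proof -
  have "finite (spt (f \<otimes>\<^bsub>S\<^esub> h))"
    using spt_mult_subset[OF assms] finite_spt assms by (meson finite_SigmaI finite_imageI finite_subset)
  moreover have "(f \<otimes>\<^bsub>S\<^esub> h) x \<in> carrier R" if x: "x \<in> carrier G" for x
    using group_ring_mult[OF assms x finite_spt[OF assms(1)] order_refl spt_subset] x assms
      spt_subset[of f]
    by (auto intro!: R.finsum_closed)
  moreover have "f \<otimes>\<^bsub>S\<^esub> h \<in> extensional (carrier G)" by (simp add: group_ring_def)
  ultimately show ?thesis by (auto simp: group_ring_carrier PiE_iff)
qed

text \<open>Both sides expand to one double sum over \<open>F\<close>, the support of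
  \<open>f\<close>, and \<open>P\<close>, the products of the supports of \<open>f\<close> and
  \<open>h\<close>.\<close>

lemma group_ring_mult_assoc:
  assumes f: "f \<in> carrier S" and h: "h \<in> carrier S" and k: "k \<in> carrier S"
  shows "f \<otimes>\<^bsub>S\<^esub> h \<otimes>\<^bsub>S\<^esub> k = f \<otimes>\<^bsub>S\<^esub> (h \<otimes>\<^bsub>S\<^esub> k)"
proof (rule group_ring_eqI)
  fix x assume x: "x \<in> carrier G"
  define F where "F = spt f"
  define P where "P = (\<lambda>(x, y). x \<otimes> y) ` (spt f \<times> spt h)"
  have F: "finite F" "F \<subseteq> carrier G" using finite_spt[OF f] spt_subset by (auto simp: F_def)
  have P: "finite P" "P \<subseteq> carrier G" using finite_spt f h spt_subset by (auto simp: P_def dest: subsetD[OF spt_subset])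
  have "(f \<otimes>\<^bsub>S\<^esub> h \<otimes>\<^bsub>S\<^esub> k) x = (\<Oplus>\<^bsub>R\<^esub>y\<in>P. (f \<otimes>\<^bsub>S\<^esub> h) y \<otimes>\<^bsub>R\<^esub> k (inv y \<otimes> x))"
    using f h k x P spt_mult_subset[OF f h] by (intro group_ring_mult group_ring_mult_closed) (auto simp: P_def)
  also have "\<dots> = (\<Oplus>\<^bsub>R\<^esub>y\<in>P. \<Oplus>\<^bsub>R\<^esub>z\<in>F. f z \<otimes>\<^bsub>R\<^esub> h (inv z \<otimes> y) \<otimes>\<^bsub>R\<^esub> k (inv y \<otimes> x))"
  proof (intro R.finsum_cong')
    fix y assume "y \<in> P"
    then have y: "y \<in> carrier G" using P by auto
    have "(f \<otimes>\<^bsub>S\<^esub> h) y \<otimes>\<^bsub>R\<^esub> k (inv y \<otimes> x) = (\<Oplus>\<^bsub>R\<^esub>z\<in>F. f z \<otimes>\<^bsub>R\<^esub> h (inv z \<otimes> y)) \<otimes>\<^bsub>R\<^esub> k (inv y \<otimes> x)"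
      using group_ring_mult[OF f h y F(1) _ F(2)] by (simp add: F_def)
    also have "\<dots> = (\<Oplus>\<^bsub>R\<^esub>z\<in>F. f z \<otimes>\<^bsub>R\<^esub> h (inv z \<otimes> y) \<otimes>\<^bsub>R\<^esub> k (inv y \<otimes> x))"
      using f h k x y F by (intro R.finsum_ldistr) (auto simp: subset_iff)
    finally show "(f \<otimes>\<^bsub>S\<^esub> h) y \<otimes>\<^bsub>R\<^esub> k (inv y \<otimes> x) = (\<Oplus>\<^bsub>R\<^esub>z\<in>F. f z \<otimes>\<^bsub>R\<^esub> h (inv z \<otimes> y) \<otimes>\<^bsub>R\<^esub> k (inv y \<otimes> x))" .
  qed (use f h k x F P in \<open>auto intro!: R.finsum_closed simp: subset_iff\<close>)
  also have "\<dots> = (\<Oplus>\<^bsub>R\<^esub>z\<in>F. \<Oplus>\<^bsub>R\<^esub>y\<in>P. f z \<otimes>\<^bsub>R\<^esub> h (inv z \<otimes> y) \<otimes>\<^bsub>R\<^esub> k (inv y \<otimes> x))"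
    using f h k x F P by (intro R.finsum_swap) (auto simp: subset_iff)
  also have "\<dots> = (\<Oplus>\<^bsub>R\<^esub>z\<in>F. f z \<otimes>\<^bsub>R\<^esub> (h \<otimes>\<^bsub>S\<^esub> k) (inv z \<otimes> x))"
  proof (intro R.finsum_cong')
    fix z assume zF: "z \<in> F"
    then have z: "z \<in> carrier G" using F by auto
    \<comment> \<open>This translate of \<open>P\<close> contains the support of \<open>h\<close>,
      so the inner product may be summed over it and then reindexed back to
      \<open>P\<close>.\<close>
    define Q where "Q = (\<lambda>y. inv z \<otimes> y) ` P"
    have Q: "finite Q" "Q \<subseteq> carrier G" using P z by (auto simp: Q_def)
    have "w \<in> Q" if w: "w \<in> spt h" for w
    proof -
      have wc: "w \<in> carrier G" using w spt_subset by auto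
      have "z \<otimes> w \<in> P" using w zF by (force simp: P_def F_def)
      moreover have "w = inv z \<otimes> (z \<otimes> w)" using wc z by (simp add: G.m_assoc[symmetric])
      ultimately show ?thesis unfolding Q_def by blast
    qed
    then have "(h \<otimes>\<^bsub>S\<^esub> k) (inv z \<otimes> x) = (\<Oplus>\<^bsub>R\<^esub>w\<in>Q. h w \<otimes>\<^bsub>R\<^esub> k (inv w \<otimes> (inv z \<otimes> x)))"
      using h k x z Q by (intro group_ring_mult) auto
    also have "\<dots> = (\<Oplus>\<^bsub>R\<^esub>y\<in>P. h (inv z \<otimes> y) \<otimes>\<^bsub>R\<^esub> k (inv (inv z \<otimes> y) \<otimes> (inv z \<otimes> x)))"
      unfolding Q_def using h k x z P
      by (intro R.finsum_reindex) (auto simp: inj_on_def subset_iff)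
    also have "\<dots> = (\<Oplus>\<^bsub>R\<^esub>y\<in>P. h (inv z \<otimes> y) \<otimes>\<^bsub>R\<^esub> k (inv y \<otimes> x))"
    proof (intro R.finsum_cong')
      fix y assume "y \<in> P"
      then have y: "y \<in> carrier G" using P by auto
      have "z \<otimes> (inv z \<otimes> x) = x" using x z by (simp flip: G.m_assoc)
      then have "inv (inv z \<otimes> y) \<otimes> (inv z \<otimes> x) = inv y \<otimes> x"
        using x y z by (simp add: G.inv_mult_group G.m_assoc)
      then show "h (inv z \<otimes> y) \<otimes>\<^bsub>R\<^esub> k (inv (inv z \<otimes> y) \<otimes> (inv z \<otimes> x)) = h (inv z \<otimes> y) \<otimes>\<^bsub>R\<^esub> k (inv y \<otimes> x)"
        by simp
    qed (use h k x z P in \<open>auto simp: subset_iff\<close>)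
    finally have "f z \<otimes>\<^bsub>R\<^esub> (h \<otimes>\<^bsub>S\<^esub> k) (inv z \<otimes> x) = (\<Oplus>\<^bsub>R\<^esub>y\<in>P. f z \<otimes>\<^bsub>R\<^esub> (h (inv z \<otimes> y) \<otimes>\<^bsub>R\<^esub> k (inv y \<otimes> x)))"
      using f h k x z P by (simp add: R.finsum_rdistr Pi_def subset_iff)
    also have "\<dots> = (\<Oplus>\<^bsub>R\<^esub>y\<in>P. f z \<otimes>\<^bsub>R\<^esub> h (inv z \<otimes> y) \<otimes>\<^bsub>R\<^esub> k (inv y \<otimes> x))"
      using f h k x z P by (intro R.finsum_cong') (auto simp: subset_iff R.m_assoc)
    finally show "(\<Oplus>\<^bsub>R\<^esub>y\<in>P. f z \<otimes>\<^bsub>R\<^esub> h (inv z \<otimes> y) \<otimes>\<^bsub>R\<^esub> k (inv y \<otimes> x)) = f z \<otimes>\<^bsub>R\<^esub> (h \<otimes>\<^bsub>S\<^esub> k) (inv z \<otimes> x)" ..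
  qed (use f h k x F in \<open>auto simp: subset_iff group_ring_mult_closed\<close>)
  also have "\<dots> = (f \<otimes>\<^bsub>S\<^esub> (h \<otimes>\<^bsub>S\<^esub> k)) x"
    using f h k x F by (intro group_ring_mult[symmetric] group_ring_mult_closed) (auto simp: F_def)
  finally show "(f \<otimes>\<^bsub>S\<^esub> h \<otimes>\<^bsub>S\<^esub> k) x = (f \<otimes>\<^bsub>S\<^esub> (h \<otimes>\<^bsub>S\<^esub> k)) x" .
qed (use assms in \<open>auto intro!: group_ring_mult_closed\<close>)

end

section \<open>Ring axioms for the group ring\<close>

sublocale group_and_ring \<subseteq> S: ring "group_ring R G"
proof (rule ringI)
  show "abelian_group S"
  proof (rule abelian_groupI)
    fix f assume f: "f \<in> carrier S"
    define h where "h = (\<lambda>x\<in>carrier G. \<ominus>\<^bsub>R\<^esub> f x)"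
    have "h \<in> carrier S"
      using f finite_spt[OF f] by (intro group_ring_memI[of _ "spt f"]) (auto simp: h_def supp_def)
    moreover have "h \<oplus>\<^bsub>S\<^esub> f = \<zero>\<^bsub>S\<^esub>"
      using calculation f
      by (intro group_ring_eqI group_ring_add_closed group_ring_zero_closed) (auto simp: h_def R.l_neg)
    ultimately show "\<exists>h\<in>carrier S. h \<oplus>\<^bsub>S\<^esub> f = \<zero>\<^bsub>S\<^esub>" by blast
  qed (auto intro!: group_ring_eqI group_ring_add_closed group_ring_zero_closed simp: R.a_ac)
  show "monoid S"
  proof (rule monoidI)
    fix f assume f: "f \<in> carrier S"
    show "\<one>\<^bsub>S\<^esub> \<otimes>\<^bsub>S\<^esub> f = f"
    proof (intro group_ring_eqI group_ring_mult_closed group_ring_one_closed f)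
      fix x assume x: "x \<in> carrier G"
      have "(\<one>\<^bsub>S\<^esub> \<otimes>\<^bsub>S\<^esub> f) x = (\<Oplus>\<^bsub>R\<^esub>y\<in>{\<one>}. \<one>\<^bsub>S\<^esub> y \<otimes>\<^bsub>R\<^esub> f (inv y \<otimes> x))"
        using f x by (intro group_ring_mult group_ring_one_closed) (auto simp: supp_def group_ring_one split: if_splits)
      then show "(\<one>\<^bsub>S\<^esub> \<otimes>\<^bsub>S\<^esub> f) x = f x" using f x by (simp add: group_ring_one)
    qed
    show "f \<otimes>\<^bsub>S\<^esub> \<one>\<^bsub>S\<^esub> = f"
    proof (intro group_ring_eqI group_ring_mult_closed group_ring_one_closed f)
      fix x assume x: "x \<in> carrier G"
      \<comment> \<open>\<open>x\<close> is inserted because \<open>f x\<close> may vanish; the only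
        term that can survive is then always indexed.\<close>
      have "(f \<otimes>\<^bsub>S\<^esub> \<one>\<^bsub>S\<^esub>) x = (\<Oplus>\<^bsub>R\<^esub>y\<in>insert x (spt f). f y \<otimes>\<^bsub>R\<^esub> \<one>\<^bsub>S\<^esub> (inv y \<otimes> x))"
        using f x by (intro group_ring_mult group_ring_one_closed) (auto simp: supp_def dest: finite_spt)
      also have "\<dots> = (\<Oplus>\<^bsub>R\<^esub>y\<in>insert x (spt f). if x = y then f y else \<zero>\<^bsub>R\<^esub>)"
      proof (intro R.finsum_cong')
        fix y assume "y \<in> insert x (spt f)"
        then have y: "y \<in> carrier G" using x spt_subset by auto
        then have "inv y \<otimes> x = \<one> \<longleftrightarrow> x = y"
          using x by (metis G.inv_equality G.inv_inv G.inv_closed G.l_inv)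
        then show "f y \<otimes>\<^bsub>R\<^esub> \<one>\<^bsub>S\<^esub> (inv y \<otimes> x) = (if x = y then f y else \<zero>\<^bsub>R\<^esub>)"
          using x y f by (simp add: group_ring_one)
      qed (use f x in \<open>auto dest: subsetD[OF spt_subset]\<close>)
      also have "\<dots> = f x"
        using f x finite_spt[OF f] by (intro R.finsum_singleton) (auto dest: subsetD[OF spt_subset])
      finally show "(f \<otimes>\<^bsub>S\<^esub> \<one>\<^bsub>S\<^esub>) x = f x" .
    qed
  qed (auto intro: group_ring_mult_closed group_ring_one_closed group_ring_mult_assoc)
next
  fix f h k assume c: "f \<in> carrier S" "h \<in> carrier S" "k \<in> carrier S"
  show "(f \<oplus>\<^bsub>S\<^esub> h) \<otimes>\<^bsub>S\<^esub> k = f \<otimes>\<^bsub>S\<^esub> k \<oplus>\<^bsub>S\<^esub> h \<otimes>\<^bsub>S\<^esub> k"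
  proof (intro group_ring_eqI group_ring_mult_closed group_ring_add_closed c)
    fix x assume x: "x \<in> carrier G"
    define F where "F = spt f \<union> spt h"
    have F: "finite F" "F \<subseteq> carrier G" "spt f \<subseteq> F" "spt h \<subseteq> F" "spt (f \<oplus>\<^bsub>S\<^esub> h) \<subseteq> F"
      using c finite_spt by (auto simp: F_def) (auto simp: supp_def)
    have "((f \<oplus>\<^bsub>S\<^esub> h) \<otimes>\<^bsub>S\<^esub> k) x = (\<Oplus>\<^bsub>R\<^esub>y\<in>F. (f \<oplus>\<^bsub>S\<^esub> h) y \<otimes>\<^bsub>R\<^esub> k (inv y \<otimes> x))"
      using c x F by (intro group_ring_mult group_ring_add_closed)
    also have "\<dots> = (\<Oplus>\<^bsub>R\<^esub>y\<in>F. f y \<otimes>\<^bsub>R\<^esub> k (inv y \<otimes> x) \<oplus>\<^bsub>R\<^esub> h y \<otimes>\<^bsub>R\<^esub> k (inv y \<otimes> x))"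
      using c x F by (intro R.finsum_cong') (auto simp: subset_iff R.l_distr)
    also have "\<dots> = (\<Oplus>\<^bsub>R\<^esub>y\<in>F. f y \<otimes>\<^bsub>R\<^esub> k (inv y \<otimes> x)) \<oplus>\<^bsub>R\<^esub> (\<Oplus>\<^bsub>R\<^esub>y\<in>F. h y \<otimes>\<^bsub>R\<^esub> k (inv y \<otimes> x))"
      using c x F by (intro R.finsum_addf) (auto simp: subset_iff)
    finally show "((f \<oplus>\<^bsub>S\<^esub> h) \<otimes>\<^bsub>S\<^esub> k) x = (f \<otimes>\<^bsub>S\<^esub> k \<oplus>\<^bsub>S\<^esub> h \<otimes>\<^bsub>S\<^esub> k) x"
      using c x F by (simp add: group_ring_mult)
  qed
  show "k \<otimes>\<^bsub>S\<^esub> (f \<oplus>\<^bsub>S\<^esub> h) = k \<otimes>\<^bsub>S\<^esub> f \<oplus>\<^bsub>S\<^esub> k \<otimes>\<^bsub>S\<^esub> h"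
  proof (intro group_ring_eqI group_ring_mult_closed group_ring_add_closed c)
    fix x assume x: "x \<in> carrier G"
    define F where "F = spt k"
    have F: "finite F" "F \<subseteq> carrier G" "spt k \<subseteq> F"
      using c finite_spt by (auto simp: F_def) (auto simp: supp_def)
    have "(k \<otimes>\<^bsub>S\<^esub> (f \<oplus>\<^bsub>S\<^esub> h)) x = (\<Oplus>\<^bsub>R\<^esub>y\<in>F. k y \<otimes>\<^bsub>R\<^esub> (f \<oplus>\<^bsub>S\<^esub> h) (inv y \<otimes> x))"
      using c x F by (intro group_ring_mult group_ring_add_closed)
    also have "\<dots> = (\<Oplus>\<^bsub>R\<^esub>y\<in>F. k y \<otimes>\<^bsub>R\<^esub> f (inv y \<otimes> x) \<oplus>\<^bsub>R\<^esub> k y \<otimes>\<^bsub>R\<^esub> h (inv y \<otimes> x))"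
      using c x F by (intro R.finsum_cong') (auto simp: subset_iff R.r_distr)
    also have "\<dots> = (\<Oplus>\<^bsub>R\<^esub>y\<in>F. k y \<otimes>\<^bsub>R\<^esub> f (inv y \<otimes> x)) \<oplus>\<^bsub>R\<^esub> (\<Oplus>\<^bsub>R\<^esub>y\<in>F. k y \<otimes>\<^bsub>R\<^esub> h (inv y \<otimes> x))"
      using c x F by (intro R.finsum_addf) (auto simp: subset_iff)
    finally show "(k \<otimes>\<^bsub>S\<^esub> (f \<oplus>\<^bsub>S\<^esub> h)) x = (k \<otimes>\<^bsub>S\<^esub> f \<oplus>\<^bsub>S\<^esub> k \<otimes>\<^bsub>S\<^esub> h) x"
      using c x F by (simp add: group_ring_mult)
  qed
qed

section \<open>Monomials and the augmentation homomorphism\<close>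

context group_and_ring
begin

text \<open>The formal product \<open>rg\<close>; for \<open>g\<close> outside
  \<open>carrier G\<close> it is the zero function. On the group, \<open>\<delta>\<close> is the
  canonical map into the group ring.\<close>

definition monomial where
  "monomial r g = (\<lambda>x\<in>carrier G. if x = g then r else \<zero>\<^bsub>R\<^esub>)"

abbreviation \<delta> where "\<delta> \<equiv> monomial \<one>\<^bsub>R\<^esub>"

lemma monomial_apply [simp]: "x \<in> carrier G \<Longrightarrow> monomial r g x = (if x = g then r else \<zero>\<^bsub>R\<^esub>)"
  by (simp add: monomial_def)

lemma monomial_closed [simp]: "r \<in> carrier R \<Longrightarrow> monomial r g \<in> carrier S"
  by (rule group_ring_memI[of _ "{g}"]) (auto simp: monomial_def)

lemma spt_monomial: "spt (monomial r g) \<subseteq> {g}"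
  by (auto simp: supp_def split: if_splits)

lemma monomial_mult_apply:
  assumes r: "r \<in> carrier R" and g: "g \<in> carrier G" and f: "f \<in> carrier S" and x: "x \<in> carrier G"
  shows "(monomial r g \<otimes>\<^bsub>S\<^esub> f) x = r \<otimes>\<^bsub>R\<^esub> f (inv g \<otimes> x)"
proof -
  have "(monomial r g \<otimes>\<^bsub>S\<^esub> f) x = (\<Oplus>\<^bsub>R\<^esub>y\<in>{g}. monomial r g y \<otimes>\<^bsub>R\<^esub> f (inv y \<otimes> x))"
    using r g f x spt_monomial by (intro group_ring_mult) auto
  then show ?thesis using r g f x by simp
qed

lemma mult_monomial_apply:
  assumes r: "r \<in> carrier R" and g: "g \<in> carrier G" and f: "f \<in> carrier S" and x: "x \<in> carrier G"
  shows "(f \<otimes>\<^bsub>S\<^esub> monomial r g) x = f (x \<otimes> inv g) \<otimes>\<^bsub>R\<^esub> r"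
proof -
  \<comment> \<open>The point \<open>x \<otimes> inv g\<close> carries the only term that can
    survive, but it may lie outside the support of \<open>f\<close>.\<close>
  let ?F = "insert (x \<otimes> inv g) (spt f)"
  have F: "finite ?F" "?F \<subseteq> carrier G"
    using x g finite_spt[OF f] spt_subset by auto
  have "(f \<otimes>\<^bsub>S\<^esub> monomial r g) x = (\<Oplus>\<^bsub>R\<^esub>y\<in>?F. f y \<otimes>\<^bsub>R\<^esub> monomial r g (inv y \<otimes> x))"
    using r f x F by (intro group_ring_mult) auto
  also have "\<dots> = (\<Oplus>\<^bsub>R\<^esub>y\<in>?F. if x \<otimes> inv g = y then f y \<otimes>\<^bsub>R\<^esub> r else \<zero>\<^bsub>R\<^esub>)"
  proof (intro R.finsum_cong')
    fix y assume "y \<in> ?F"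
    then have y: "y \<in> carrier G" using F by auto
    have "inv y \<otimes> x = g \<longleftrightarrow> x \<otimes> inv g = y"
      using G.inv_solve_left'[of g y x] G.inv_solve_right'[of y x g] x y g by auto
    then show "f y \<otimes>\<^bsub>R\<^esub> monomial r g (inv y \<otimes> x) = (if x \<otimes> inv g = y then f y \<otimes>\<^bsub>R\<^esub> r else \<zero>\<^bsub>R\<^esub>)"
      using x y f by simp
  qed (use F f r x g in \<open>auto simp: subset_iff\<close>)
  also have "\<dots> = f (x \<otimes> inv g) \<otimes>\<^bsub>R\<^esub> r"
    using F f r by (intro R.finsum_singleton) (auto simp: subset_iff)
  finally show ?thesis .
qed

lemma monomial_mult_monomial:
  assumes "r \<in> carrier R" "s \<in> carrier R" "g \<in> carrier G" "h \<in> carrier G"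
  shows "monomial r g \<otimes>\<^bsub>S\<^esub> monomial s h = monomial (r \<otimes>\<^bsub>R\<^esub> s) (g \<otimes> h)"
proof (rule group_ring_eqI)
  fix x assume x: "x \<in> carrier G"
  have "inv g \<otimes> x = h \<longleftrightarrow> x = g \<otimes> h"
    using G.inv_solve_left'[of h g x] assms x by auto
  then show "(monomial r g \<otimes>\<^bsub>S\<^esub> monomial s h) x = monomial (r \<otimes>\<^bsub>R\<^esub> s) (g \<otimes> h) x"
    using assms x by (simp add: monomial_mult_apply)
qed (use assms in auto)

lemma \<delta>_one: "\<delta> \<one> = \<one>\<^bsub>S\<^esub>"
  by (rule group_ring_eqI) (simp_all add: group_ring_one)

definition augmentation where
  "augmentation f = (\<Oplus>\<^bsub>R\<^esub>x\<in>spt f. f x)"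

lemma augmentation_eq:
  assumes "f \<in> carrier S" "finite F" "spt f \<subseteq> F" "F \<subseteq> carrier G"
  shows "augmentation f = (\<Oplus>\<^bsub>R\<^esub>x\<in>F. f x)"
  unfolding augmentation_def using assms
  by (intro R.add.finprod_mono_neutral_cong_left) (auto simp: supp_def subset_iff)

lemma augmentation_monomial:
  assumes "r \<in> carrier R" "g \<in> carrier G"
  shows "augmentation (monomial r g) = r"
  using augmentation_eq[of "monomial r g" "{g}"] spt_monomial assms by simp

text \<open>After interchanging the sums, the inner one runs over a translate of \<open>P\<close>
  that contains the support of \<open>h\<close>, so it equals \<open>augmentation h\<close> for
  every \<open>y\<close>.\<close>

lemma augmentation_mult:
  assumes f: "f \<in> carrier S" and h: "h \<in> carrier S"
  shows "augmentation (f \<otimes>\<^bsub>S\<^esub> h) = augmentation f \<otimes>\<^bsub>R\<^esub> augmentation h"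
proof -
  define F where "F = spt f"
  define P where "P = (\<lambda>(x, y). x \<otimes> y) ` (spt f \<times> spt h)"
  have F: "finite F" "F \<subseteq> carrier G" using finite_spt[OF f] spt_subset by (auto simp: F_def)
  have P: "finite P" "P \<subseteq> carrier G"
    using finite_spt f h by (auto simp: P_def dest: subsetD[OF spt_subset])
  have "augmentation (f \<otimes>\<^bsub>S\<^esub> h) = (\<Oplus>\<^bsub>R\<^esub>x\<in>P. (f \<otimes>\<^bsub>S\<^esub> h) x)"
    using f h P spt_mult_subset by (intro augmentation_eq) (auto simp: P_def)
  also have "\<dots> = (\<Oplus>\<^bsub>R\<^esub>x\<in>P. \<Oplus>\<^bsub>R\<^esub>y\<in>F. f y \<otimes>\<^bsub>R\<^esub> h (inv y \<otimes> x))"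
    using f h P F by (intro R.finsum_cong' group_ring_mult) (auto simp: F_def subset_iff intro!: R.finsum_closed)
  also have "\<dots> = (\<Oplus>\<^bsub>R\<^esub>y\<in>F. \<Oplus>\<^bsub>R\<^esub>x\<in>P. f y \<otimes>\<^bsub>R\<^esub> h (inv y \<otimes> x))"
    using f h P F by (intro R.finsum_swap) (auto simp: subset_iff)
  also have "\<dots> = (\<Oplus>\<^bsub>R\<^esub>y\<in>F. f y \<otimes>\<^bsub>R\<^esub> augmentation h)"
  proof (intro R.finsum_cong')
    fix y assume yF: "y \<in> F"
    then have y: "y \<in> carrier G" using F by auto
    have "w \<in> (\<lambda>x. inv y \<otimes> x) ` P" if w: "w \<in> spt h" for w
    proof -
      have wc: "w \<in> carrier G" using w spt_subset by auto
      have "y \<otimes> w \<in> P" using w yF by (force simp: P_def F_def)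
      moreover have "w = inv y \<otimes> (y \<otimes> w)" using wc y by (simp flip: G.m_assoc)
      ultimately show ?thesis by blast
    qed
    then have "augmentation h = (\<Oplus>\<^bsub>R\<^esub>w\<in>(\<lambda>x. inv y \<otimes> x) ` P. h w)"
      using h P y by (intro augmentation_eq) (auto simp: subset_iff)
    also have "\<dots> = (\<Oplus>\<^bsub>R\<^esub>x\<in>P. h (inv y \<otimes> x))"
      using h P y by (intro R.finsum_reindex) (auto simp: inj_on_def subset_iff)
    finally show "(\<Oplus>\<^bsub>R\<^esub>x\<in>P. f y \<otimes>\<^bsub>R\<^esub> h (inv y \<otimes> x)) = f y \<otimes>\<^bsub>R\<^esub> augmentation h"
      using f h P y by (simp add: R.finsum_rdistr Pi_def subset_iff)
  qed (use f h F in \<open>auto simp: augmentation_def subset_iff supp_def intro!: R.finsum_closed\<close>)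
  also have "\<dots> = augmentation f \<otimes>\<^bsub>R\<^esub> augmentation h"
    unfolding augmentation_def F_def[symmetric] using f h F
    by (intro R.finsum_ldistr[symmetric] R.finsum_closed) (auto simp: subset_iff supp_def)
  finally show ?thesis .
qed

lemma augmentation_add:
  assumes f: "f \<in> carrier S" and h: "h \<in> carrier S"
  shows "augmentation (f \<oplus>\<^bsub>S\<^esub> h) = augmentation f \<oplus>\<^bsub>R\<^esub> augmentation h"
proof -
  define F where "F = spt f \<union> spt h"
  have F: "finite F" "F \<subseteq> carrier G" "spt f \<subseteq> F" "spt h \<subseteq> F" "spt (f \<oplus>\<^bsub>S\<^esub> h) \<subseteq> F"
    using f h finite_spt by (auto simp: F_def) (auto simp: supp_def)
  have "augmentation (f \<oplus>\<^bsub>S\<^esub> h) = (\<Oplus>\<^bsub>R\<^esub>x\<in>F. (f \<oplus>\<^bsub>S\<^esub> h) x)"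
    using f h F by (intro augmentation_eq) auto
  also have "\<dots> = (\<Oplus>\<^bsub>R\<^esub>x\<in>F. f x \<oplus>\<^bsub>R\<^esub> h x)"
    using f h F by (intro R.finsum_cong') (auto simp: subset_iff)
  also have "\<dots> = (\<Oplus>\<^bsub>R\<^esub>x\<in>F. f x) \<oplus>\<^bsub>R\<^esub> (\<Oplus>\<^bsub>R\<^esub>x\<in>F. h x)"
    using f h F by (intro R.finsum_addf) (auto simp: subset_iff)
  finally show ?thesis using f h F by (simp add: augmentation_eq)
qed

lemma augmentation_ring_hom: "ring_hom_ring S R augmentation"
proof (rule ring_hom_ringI2[OF S.ring_axioms R.ring_axioms], rule ring_hom_memI)
  show "augmentation \<one>\<^bsub>S\<^esub> = \<one>\<^bsub>R\<^esub>"
    using augmentation_monomial[of "\<one>\<^bsub>R\<^esub>" \<one>] by (simp add: \<delta>_one)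
  show "augmentation f \<in> carrier R" if "f \<in> carrier S" for f
    using that by (auto simp: augmentation_def supp_def intro!: R.finsum_closed)
qed (simp_all add: augmentation_add augmentation_mult)

sublocale aug: ring_hom_ring S R augmentation
  by (rule augmentation_ring_hom)

section \<open>Consequences of regularity of the group ring\<close>

lemma regular_coefficient_ring:
  assumes reg: "\<And>a. a \<in> carrier S \<Longrightarrow> \<exists>b\<in>carrier S. a = a \<otimes>\<^bsub>S\<^esub> b \<otimes>\<^bsub>S\<^esub> a"
    and r: "r \<in> carrier R"
  shows "\<exists>s\<in>carrier R. r = r \<otimes>\<^bsub>R\<^esub> s \<otimes>\<^bsub>R\<^esub> r"
proof -
  \<comment> \<open>Regularity passes to homomorphic images, and \<open>monomial r \<one>\<close> is
    a preimage of \<open>r\<close> under the augmentation.\<close>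
  obtain b where b: "b \<in> carrier S" "monomial r \<one> = monomial r \<one> \<otimes>\<^bsub>S\<^esub> b \<otimes>\<^bsub>S\<^esub> monomial r \<one>"
    using reg[of "monomial r \<one>"] r by auto
  have "augmentation (monomial r \<one>) = augmentation (monomial r \<one> \<otimes>\<^bsub>S\<^esub> b \<otimes>\<^bsub>S\<^esub> monomial r \<one>)"
    using b(2) by simp
  then show ?thesis using b(1) r by (auto simp: augmentation_monomial)
qed

text \<open>Left multiplication keeps the invariance already gained, so \<open>e\<close> may be
  corrected by a left factor. For \<open>p = 1 - bc\<close> regularity gives \<open>pb = 0\<close>,
  which turns \<open>eg = e - b\<close> into \<open>peg = pe\<close>; as \<open>b\<close> has
  augmentation 0, \<open>p\<close> has augmentation 1.\<close>

lemma exists_right_invariant: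
  assumes reg: "\<And>a. a \<in> carrier S \<Longrightarrow> \<exists>b\<in>carrier S. a = a \<otimes>\<^bsub>S\<^esub> b \<otimes>\<^bsub>S\<^esub> a"
    and "finite A" "A \<subseteq> carrier G"
  shows "\<exists>z\<in>carrier S. augmentation z = \<one>\<^bsub>R\<^esub> \<and> (\<forall>g\<in>A. z \<otimes>\<^bsub>S\<^esub> \<delta> g = z)"
  using assms(2,3)
proof (induction A)
  case empty
  then show ?case by (intro bexI[of _ "\<one>\<^bsub>S\<^esub>"]) auto
next
  case (insert g A)
  then obtain e where e: "e \<in> carrier S" "augmentation e = \<one>\<^bsub>R\<^esub>" "\<forall>h\<in>A. e \<otimes>\<^bsub>S\<^esub> \<delta> h = e" by auto
  have g: "g \<in> carrier G" using insert by auto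
  define b where "b = e \<ominus>\<^bsub>S\<^esub> e \<otimes>\<^bsub>S\<^esub> \<delta> g"
  have b: "b \<in> carrier S" using e by (simp add: b_def)
  then obtain c where c: "c \<in> carrier S" "b = b \<otimes>\<^bsub>S\<^esub> c \<otimes>\<^bsub>S\<^esub> b" using reg by blast
  define z where "z = (\<one>\<^bsub>S\<^esub> \<ominus>\<^bsub>S\<^esub> b \<otimes>\<^bsub>S\<^esub> c) \<otimes>\<^bsub>S\<^esub> e"
  have "augmentation b = \<zero>\<^bsub>R\<^esub>"
    using e g by (simp add: b_def S.minus_eq augmentation_monomial R.r_neg)
  then have "augmentation z = \<one>\<^bsub>R\<^esub>"
    using e b c by (simp add: z_def S.minus_eq R.minus_zero)
  moreover have "z \<otimes>\<^bsub>S\<^esub> \<delta> h = z" if "h \<in> insert g A" for h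
  proof (cases "h \<in> A")
    case True
    then show ?thesis using e b c by (simp add: z_def S.m_assoc)
  next
    case False
    then have "h = g" using that by simp
    define p where "p = \<one>\<^bsub>S\<^esub> \<ominus>\<^bsub>S\<^esub> b \<otimes>\<^bsub>S\<^esub> c"
    have p: "p \<in> carrier S" using b c(1) by (simp add: p_def)
    have "p \<otimes>\<^bsub>S\<^esub> b = b \<ominus>\<^bsub>S\<^esub> b \<otimes>\<^bsub>S\<^esub> c \<otimes>\<^bsub>S\<^esub> b"
      using b c(1) by (simp add: p_def S.minus_eq S.l_distr S.l_minus)
    then have pb: "p \<otimes>\<^bsub>S\<^esub> b = \<zero>\<^bsub>S\<^esub>"
      using b by (simp add: S.minus_eq S.r_neg flip: c(2))
    have "e \<otimes>\<^bsub>S\<^esub> \<delta> g = e \<ominus>\<^bsub>S\<^esub> b"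
      using e(1) by (simp add: b_def S.minus_eq S.minus_add S.r_neg flip: S.a_assoc)
    then have "z \<otimes>\<^bsub>S\<^esub> \<delta> g = p \<otimes>\<^bsub>S\<^esub> (e \<ominus>\<^bsub>S\<^esub> b)"
      using e(1) p by (simp add: z_def S.m_assoc flip: p_def)
    also have "\<dots> = p \<otimes>\<^bsub>S\<^esub> e"
      using e(1) b p pb by (simp add: S.minus_eq S.r_distr S.r_minus)
    finally show ?thesis using \<open>h = g\<close> by (simp add: z_def p_def)
  qed
  moreover have "z \<in> carrier S" using e b c by (simp add: z_def)
  ultimately show ?case by blast
qed

text \<open>An invariant \<open>z\<close> is constant on the left cosets of the generated subgroup
  \<open>H\<close>. Its support is finite, nonempty and a union of such cosets, so \<open>H\<close>
  is finite. Each coset contributes \<open>card H\<close> times a coefficient, and the total is the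
  augmentation 1.\<close>

lemma regular_imp_finite_and_invertible_card:
  assumes reg: "\<And>a. a \<in> carrier S \<Longrightarrow> \<exists>b\<in>carrier S. a = a \<otimes>\<^bsub>S\<^esub> b \<otimes>\<^bsub>S\<^esub> a"
    and nontriv: "\<one>\<^bsub>R\<^esub> \<noteq> \<zero>\<^bsub>R\<^esub>" and A: "finite A" "A \<subseteq> carrier G"
  shows "finite (generate G A)" and "\<exists>r\<in>carrier R. [card (generate G A)] \<cdot>\<^bsub>R\<^esub> r = \<one>\<^bsub>R\<^esub>"
proof -
  obtain z where z: "z \<in> carrier S" "augmentation z = \<one>\<^bsub>R\<^esub>" "\<forall>g\<in>A. z \<otimes>\<^bsub>S\<^esub> \<delta> g = z"
    using exists_right_invariant[OF reg A] by auto
  define H where "H = generate G A"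
  have H: "subgroup H G" unfolding H_def by (rule G.generate_is_subgroup[OF A(2)])
  note Hc = subgroup.mem_carrier[OF H]
  \<comment> \<open>The right stabilizer of \<open>z\<close>: a subgroup containing
    \<open>A\<close>, hence containing \<open>H\<close>.\<close>
  define T where "T = {g \<in> carrier G. \<forall>x\<in>carrier G. z (x \<otimes> g) = z x}"
  have T: "subgroup T G"
  proof (rule G.subgroupI)
    show "inv g \<in> T" if "g \<in> T" for g
    proof -
      have g: "g \<in> carrier G" "\<And>x. x \<in> carrier G \<Longrightarrow> z (x \<otimes> g) = z x" using that by (auto simp: T_def)
      have "z (x \<otimes> inv g) = z x" if "x \<in> carrier G" for x
        using g(2)[of "x \<otimes> inv g"] g(1) that by (simp add: G.m_assoc)
      then show ?thesis using g by (simp add: T_def)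
    qed
    show "g \<otimes> h \<in> T" if "g \<in> T" "h \<in> T" for g h
      using that by (auto simp: T_def simp flip: G.m_assoc)
    have "\<one> \<in> T" by (auto simp: T_def)
    then show "T \<noteq> {}" by auto
  qed (auto simp: T_def)
  have "A \<subseteq> T"
  proof
    fix g assume g: "g \<in> A"
    then have gc: "g \<in> carrier G" using A by auto
    have "z (x \<otimes> g) = z x" if x: "x \<in> carrier G" for x
      using mult_monomial_apply[of "\<one>\<^bsub>R\<^esub>" g z "x \<otimes> g"] z g gc x by (simp add: G.m_assoc)
    then show "g \<in> T" using gc by (simp add: T_def)
  qed
  then have "H \<subseteq> T" unfolding H_def by (rule G.generate_subgroup_incl[OF _ T])
  then have inv: "z (x \<otimes> h) = z x" if "x \<in> carrier G" "h \<in> H" for x h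
    using that by (auto simp: T_def)
  have coset: "(\<lambda>h. x \<otimes> h) ` H \<subseteq> spt z" if "x \<in> spt z" for x
    using that Hc inv by (auto simp: supp_def)
  have inj: "inj_on (\<lambda>h. x \<otimes> h) H" if "x \<in> carrier G" for x
    using that Hc by (auto simp: inj_on_def)
  have "spt z \<noteq> {}" using z(2) nontriv by (auto simp: augmentation_def)
  then obtain x0 where "x0 \<in> spt z" by blast
  then have finH: "finite H"
    using coset inj finite_spt[OF z(1)] spt_subset by (meson finite_imageD finite_subset subsetD)
  then show "finite (generate G A)" by (simp add: H_def)
  \<comment> \<open>Generalizing from the support to all finite sets stable under right
    multiplication by \<open>H\<close> lets the induction remove one coset at a time.\<close>
  have coset_sum: "\<exists>r\<in>carrier R. (\<Oplus>\<^bsub>R\<^esub>x\<in>X. z x) = [card H] \<cdot>\<^bsub>R\<^esub> r"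
    if "finite X" "X \<subseteq> carrier G" "\<And>x h. x \<in> X \<Longrightarrow> h \<in> H \<Longrightarrow> x \<otimes> h \<in> X" for X
    using that
  proof (induction X rule: finite_psubset_induct)
    case (psubset X)
    show ?case
    proof (cases "X = {}")
      case True
      then show ?thesis by (intro bexI[of _ "\<zero>\<^bsub>R\<^esub>"]) auto
    next
      case False
      then obtain x where x: "x \<in> X" by blast
      then have xc: "x \<in> carrier G" using psubset.prems by auto
      define C where "C = (\<lambda>h. x \<otimes> h) ` H"
      have CX: "C \<subseteq> X" using x psubset.prems by (auto simp: C_def)
      have xC: "x \<in> C" using xc subgroup.one_closed[OF H] unfolding C_def
        by (intro image_eqI[of _ _ \<one>]) auto
      \<comment> \<open>The remainder is again stable: if \<open>y \<otimes> h\<close> fell into the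
        coset \<open>C\<close>, multiplying by \<open>inv h\<close> would put \<open>y\<close> there
        too.\<close>
      have "y \<otimes> h \<in> X - C" if y: "y \<in> X - C" and h: "h \<in> H" for y h
      proof -
        have yc: "y \<in> carrier G" using y psubset.prems by auto
        have "y \<otimes> h \<notin> C"
        proof
          assume "y \<otimes> h \<in> C"
          then obtain k where k: "k \<in> H" "y \<otimes> h = x \<otimes> k" by (auto simp: C_def)
          have "y = y \<otimes> h \<otimes> inv h" using yc h Hc by (simp add: G.m_assoc)
          also have "\<dots> = x \<otimes> (k \<otimes> inv h)" using k xc h Hc by (simp add: G.m_assoc)
          finally show False using y k(1) h subgroup.m_closed[OF H] subgroup.m_inv_closed[OF H]
            by (auto simp: C_def)
        qed
        then show ?thesis using y h psubset.prems by auto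
      qed
      then obtain r where r: "r \<in> carrier R" "(\<Oplus>\<^bsub>R\<^esub>x\<in>X - C. z x) = [card H] \<cdot>\<^bsub>R\<^esub> r"
        using psubset.IH[of "X - C"] xC x psubset.prems by blast
      have "(\<Oplus>\<^bsub>R\<^esub>y\<in>C. z y) = (\<Oplus>\<^bsub>R\<^esub>h\<in>H. z (x \<otimes> h))"
        unfolding C_def using xc Hc z(1) inj by (intro R.finsum_reindex) auto
      also have "\<dots> = (\<Oplus>\<^bsub>R\<^esub>h\<in>H. z x)"
        using xc z(1) inv by (intro R.finsum_cong') auto
      also have "\<dots> = [card H] \<cdot>\<^bsub>R\<^esub> z x"
        using xc z(1) by (intro R.add.finprod_const) auto
      finally have sumC: "(\<Oplus>\<^bsub>R\<^esub>y\<in>C. z y) = [card H] \<cdot>\<^bsub>R\<^esub> z x" .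
      have "(\<Oplus>\<^bsub>R\<^esub>y\<in>C \<union> (X - C). z y) = (\<Oplus>\<^bsub>R\<^esub>y\<in>C. z y) \<oplus>\<^bsub>R\<^esub> (\<Oplus>\<^bsub>R\<^esub>y\<in>X - C. z y)"
        using psubset.prems psubset.hyps CX z(1) finite_subset[OF CX]
        by (intro R.finsum_Un_disjoint) (auto simp: subset_iff)
      also have "\<dots> = [card H] \<cdot>\<^bsub>R\<^esub> (z x \<oplus>\<^bsub>R\<^esub> r)"
        using sumC r xc z(1) by (simp add: R.add.nat_pow_distrib)
      finally show ?thesis using CX r xc z(1)
        by (intro bexI[of _ "z x \<oplus>\<^bsub>R\<^esub> r"]) (auto simp: Un_absorb1)
    qed
  qed
  have "x \<otimes> h \<in> spt z" if "x \<in> spt z" "h \<in> H" for x h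
    using coset that by blast
  then have "\<exists>r\<in>carrier R. augmentation z = [card H] \<cdot>\<^bsub>R\<^esub> r"
    unfolding augmentation_def by (rule coset_sum[OF finite_spt[OF z(1)] spt_subset])
  then show "\<exists>r\<in>carrier R. [card (generate G A)] \<cdot>\<^bsub>R\<^esub> r = \<one>\<^bsub>R\<^esub>"
    using z(2) by (auto simp: H_def)
qed

end

section \<open>Group rings of finite subgroups and unit-regularity\<close>

context group_and_ring
begin

lemma zero_outside_spt: "spt f \<subseteq> H \<Longrightarrow> x \<in> carrier G \<Longrightarrow> x \<notin> H \<Longrightarrow> f x = \<zero>\<^bsub>R\<^esub>"
  by (auto simp: supp_def)

lemma monomial_add_pow:
  assumes "r \<in> carrier R"
  shows "monomial ([(k::nat)] \<cdot>\<^bsub>R\<^esub> r) g = [k] \<cdot>\<^bsub>S\<^esub> monomial r g"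
proof (induction k)
  case 0
  show ?case by (rule group_ring_eqI) simp_all
next
  case (Suc k)
  have "monomial ([Suc k] \<cdot>\<^bsub>R\<^esub> r) g = monomial ([k] \<cdot>\<^bsub>R\<^esub> r) g \<oplus>\<^bsub>S\<^esub> monomial r g"
    using assms by (intro group_ring_eqI) auto
  then show ?case using Suc by simp
qed

text \<open>Every coefficient is a multiple of 1, so each monomial is a repeated sum of some
  \<open>\<delta> x\<close>, and \<open>f\<close> is a finite sum of monomials. This yields the
  spanning condition required for averaging.\<close>

lemma group_ring_induct:
  assumes gen: "\<And>r. r \<in> carrier R \<Longrightarrow> \<exists>k::nat. r = [k] \<cdot>\<^bsub>R\<^esub> \<one>\<^bsub>R\<^esub>"
    and A: "\<zero>\<^bsub>S\<^esub> \<in> A" "\<And>f h. f \<in> A \<Longrightarrow> h \<in> A \<Longrightarrow> f \<oplus>\<^bsub>S\<^esub> h \<in> A" "\<And>x. x \<in> H \<Longrightarrow> \<delta> x \<in> A"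
    and f: "f \<in> carrier S" "spt f \<subseteq> H"
  shows "f \<in> A"
proof -
  have monomial: "monomial r x \<in> A" if r: "r \<in> carrier R" and x: "x \<in> H" for r x
  proof -
    have "[k] \<cdot>\<^bsub>S\<^esub> \<delta> x \<in> A" for k :: nat by (induction k) (use A x in auto)
    then show ?thesis using gen[OF r] by (metis monomial_add_pow R.one_closed)
  qed
  have "f \<in> A" if "finite F" "F \<subseteq> H" "f \<in> carrier S" "spt f \<subseteq> F" for f F
    using that
  proof (induction F arbitrary: f)
    case empty
    then have "f = \<zero>\<^bsub>S\<^esub>" by (intro group_ring_eqI) (auto simp: supp_def)
    then show ?case using A by simp
  next
    case (insert x F)
    show ?case
    proof (cases "x \<in> carrier G")
      case True
      \<comment> \<open>\<open>f\<close> with its coefficient at \<open>x\<close> erased, so that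
        the induction hypothesis applies.\<close>
      define h where "h = (\<lambda>y\<in>carrier G. if y = x then \<zero>\<^bsub>R\<^esub> else f y)"
      have h: "h \<in> carrier S"
        using insert.prems finite_spt[of f]
        by (intro group_ring_memI[of _ "spt f"]) (auto simp: h_def supp_def)
      have "spt h \<subseteq> F" using insert.prems by (auto simp: h_def supp_def split: if_splits)
      then have "h \<in> A" using insert h by simp
      moreover have "h \<oplus>\<^bsub>S\<^esub> monomial (f x) x = f"
        using insert.prems True h by (intro group_ring_eqI) (auto simp: h_def)
      moreover have "monomial (f x) x \<in> A" using monomial[of "f x" x] insert.prems True by auto
      ultimately show ?thesis using A(2) by metis
    next
      case False
      then have "spt f \<subseteq> F" using insert.prems spt_subset by blast
      then show ?thesis using insert by simp
    qed
  qed
  then show ?thesis using f finite_spt by blast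
qed

lemma supported_subring:
  assumes H: "subgroup H G"
  shows "subring {f \<in> carrier S. spt f \<subseteq> H} S"
proof (rule S.subringI)
  show "\<one>\<^bsub>S\<^esub> \<in> {f \<in> carrier S. spt f \<subseteq> H}"
    using subgroup.one_closed[OF H] spt_monomial[of "\<one>\<^bsub>R\<^esub>" \<one>] by (auto simp: \<delta>_one)
  show "\<ominus>\<^bsub>S\<^esub> f \<in> {f \<in> carrier S. spt f \<subseteq> H}" if "f \<in> {f \<in> carrier S. spt f \<subseteq> H}" for f
  proof -
    have f: "f \<in> carrier S" "spt f \<subseteq> H" using that by auto
    \<comment> \<open>The negative is given only as an additive inverse, so its values are read off
      from \<open>-f + f = 0\<close>.\<close>
    have "(\<ominus>\<^bsub>S\<^esub> f) x = \<zero>\<^bsub>R\<^esub>" if x: "x \<in> carrier G" "f x = \<zero>\<^bsub>R\<^esub>" for x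
    proof -
      have "(\<ominus>\<^bsub>S\<^esub> f \<oplus>\<^bsub>S\<^esub> f) x = \<zero>\<^bsub>R\<^esub>" using f x by (simp add: S.l_neg del: group_ring_add)
      then show ?thesis using f x by simp
    qed
    then show ?thesis using f by (auto simp: supp_def)
  qed
  show "f \<otimes>\<^bsub>S\<^esub> h \<in> {f \<in> carrier S. spt f \<subseteq> H}"
    if "f \<in> {f \<in> carrier S. spt f \<subseteq> H}" "h \<in> {f \<in> carrier S. spt f \<subseteq> H}" for f h
  proof -
    have "(\<lambda>(x, y). x \<otimes> y) ` (spt f \<times> spt h) \<subseteq> H"
      using that subgroup.m_closed[OF H] by auto
    then show ?thesis using that spt_mult_subset[of f h] by auto
  qed
  show "f \<oplus>\<^bsub>S\<^esub> h \<in> {f \<in> carrier S. spt f \<subseteq> H}"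
    if "f \<in> {f \<in> carrier S. spt f \<subseteq> H}" "h \<in> {f \<in> carrier S. spt f \<subseteq> H}" for f h
  proof -
    have "spt (f \<oplus>\<^bsub>S\<^esub> h) \<subseteq> spt f \<union> spt h" by (auto simp: supp_def)
    then show ?thesis using that by auto
  qed
qed auto

lemma finite_supported:
  assumes "finite (carrier R)" "finite H"
  shows "finite {f \<in> carrier S. spt f \<subseteq> H}"
proof -
  let ?SH = "{f \<in> carrier S. spt f \<subseteq> H}"
  have "inj_on (\<lambda>f. restrict f (H \<inter> carrier G)) ?SH"
  proof (rule inj_onI)
    fix f h assume f: "f \<in> ?SH" and h: "h \<in> ?SH"
      and eq: "restrict f (H \<inter> carrier G) = restrict h (H \<inter> carrier G)"
    show "f = h"
    proof (rule group_ring_eqI)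
      fix x assume x: "x \<in> carrier G"
      show "f x = h x"
      proof (cases "x \<in> H")
        case True
        then show ?thesis using x fun_cong[OF eq, of x] by simp
      next
        case False
        then show ?thesis using f h x zero_outside_spt[of f H x] zero_outside_spt[of h H x] by simp
      qed
    qed (use f h in auto)
  qed
  moreover have "(\<lambda>f. restrict f (H \<inter> carrier G)) ` ?SH \<subseteq> (H \<inter> carrier G) \<rightarrow>\<^sub>E carrier R"
    by (auto split: if_splits)
  moreover have "finite ((H \<inter> carrier G) \<rightarrow>\<^sub>E carrier R)"
    using assms by (intro finite_PiE) auto
  ultimately show ?thesis by (meson finite_imageD finite_subset)
qed

text \<open>Each \<open>a\<close> lies in the group ring \<open>T\<close> of the subgroup generated
  by its support, which is finite by local finiteness. Averaging makes the finite ring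
  \<open>T\<close> regular, hence unit-regular.\<close>

lemma unit_regular_group_ring:
  assumes fin: "finite (carrier R)" and nontriv: "\<one>\<^bsub>R\<^esub> \<noteq> \<zero>\<^bsub>R\<^esub>"
    and gen: "\<And>r. r \<in> carrier R \<Longrightarrow> \<exists>k::nat. r = [k] \<cdot>\<^bsub>R\<^esub> \<one>\<^bsub>R\<^esub>"
    and n: "squarefree (n::nat)" "[n] \<cdot>\<^bsub>R\<^esub> \<one>\<^bsub>R\<^esub> = \<zero>\<^bsub>R\<^esub>"
    and lf: "locally_finite_group G" and cop: "\<And>x. x \<in> carrier G \<Longrightarrow> coprime (G.ord x) n"
  shows "unit_regular_ring S"
proof (unfold_locales)
  fix a assume a: "a \<in> carrier S"
  define H where "H = generate G (spt a)"
  have H: "subgroup H G" unfolding H_def by (rule G.generate_is_subgroup[OF spt_subset])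
  have finH: "finite H"
    unfolding H_def by (rule locally_finite_group.locally_finite[OF lf spt_subset finite_spt[OF a]])
  note Hc = subgroup.mem_carrier[OF H]
  \<comment> \<open>The group ring of \<open>H\<close> is realized inside \<open>S\<close> by the
    elements supported in \<open>H\<close>, with the same operations.\<close>
  define T where "T = S\<lparr>carrier := {f \<in> carrier S. spt f \<subseteq> H}\<rparr>"
  interpret T: ring T
    unfolding T_def by (rule S.subring_is_ring[OF supported_subring[OF H]])
  have Tc: "f \<in> carrier T \<longleftrightarrow> f \<in> carrier S \<and> spt f \<subseteq> H" for f by (simp add: T_def)
  have T_simps: "monoid.mult T = monoid.mult S" "ring.add T = ring.add S"
    "monoid.one T = monoid.one S" "ring.zero T = ring.zero S"
    by (simp_all add: T_def)
  have T_pow: "[k] \<cdot>\<^bsub>T\<^esub> f = [k] \<cdot>\<^bsub>S\<^esub> f" for k :: nat and f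
    by (simp add: T_def add_pow_def nat_pow_def)
  have \<delta>T: "\<delta> h \<in> carrier T" if "h \<in> H" for h
    using that spt_monomial by (auto simp: Tc)
  have \<delta>_mult: "\<delta> g \<otimes>\<^bsub>T\<^esub> \<delta> h = \<delta> (g \<otimes> h)" if "g \<in> H" "h \<in> H" for g h
    using that Hc by (simp add: T_simps monomial_mult_monomial)
  have \<delta>1: "\<delta> \<one> = \<one>\<^bsub>T\<^esub>" by (simp add: T_simps \<delta>_one)
  have \<delta>_inv: "\<delta> (inv h) \<otimes>\<^bsub>T\<^esub> \<delta> h = \<one>\<^bsub>T\<^esub>" "\<delta> h \<otimes>\<^bsub>T\<^esub> \<delta> (inv h) = \<one>\<^bsub>T\<^esub>" if "h \<in> H" for h
    using that Hc subgroup.m_inv_closed[OF H] by (simp_all add: \<delta>_mult \<delta>1)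
  have \<delta>U: "\<delta> h \<in> Units T" if "h \<in> H" for h
    using that \<delta>T \<delta>_inv subgroup.m_inv_closed[OF H] unfolding Units_def by blast
  have \<delta>H: "subgroup (\<delta> ` H) (units_of T)"
  proof (rule group.subgroupI[OF T.units_group])
    show "inv\<^bsub>units_of T\<^esub> u \<in> \<delta> ` H" if "u \<in> \<delta> ` H" for u
    proof -
      obtain h where h: "h \<in> H" "u = \<delta> h" using \<open>u \<in> \<delta> ` H\<close> by blast
      have "inv\<^bsub>T\<^esub> u = \<delta> (inv h)"
        using h \<delta>T \<delta>_inv subgroup.m_inv_closed[OF H] by (intro T.inv_char) auto
      then show ?thesis
        using h \<delta>U subgroup.m_inv_closed[OF H] by (simp add: T.units_of_inv)
    qed
    show "u \<otimes>\<^bsub>units_of T\<^esub> v \<in> \<delta> ` H" if "u \<in> \<delta> ` H" "v \<in> \<delta> ` H" for u v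
      using that subgroup.m_closed[OF H] by (auto simp: units_of_mult \<delta>_mult)
  qed (use \<delta>U subgroup.one_closed[OF H] in \<open>auto simp: units_of_carrier\<close>)
  \<comment> \<open>As \<open>R\<close> is nontrivial, distinct group elements stay distinct in
    \<open>T\<close>, so the copy of \<open>H\<close> among the units has \<open>card H\<close>
    elements.\<close>
  have "inj_on \<delta> H"
  proof (rule inj_onI)
    fix g h assume "g \<in> H" "h \<in> H" "\<delta> g = \<delta> h"
    then have "\<delta> g g = \<delta> h g" by simp
    then show "g = h" using \<open>g \<in> H\<close> Hc nontriv by (simp split: if_splits)
  qed
  then have "card (\<delta> ` H) = card H" by (rule card_image)
  then have cop_card: "coprime (card (\<delta> ` H)) n"
    using G.coprime_card_subgroup[OF H finH] cop Hc by simp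
  have T_char: "[n] \<cdot>\<^bsub>T\<^esub> \<one>\<^bsub>T\<^esub> = \<zero>\<^bsub>T\<^esub>"
  proof -
    have "[n] \<cdot>\<^bsub>S\<^esub> \<delta> \<one> = monomial \<zero>\<^bsub>R\<^esub> \<one>" using n(2) by (simp flip: monomial_add_pow)
    also have "\<dots> = \<zero>\<^bsub>S\<^esub>" by (rule group_ring_eqI) simp_all
    finally show ?thesis by (simp add: T_pow T_simps \<delta>_one)
  qed
  have span: "carrier T \<subseteq> A" if A: "additive_subgroup A T" "\<delta> ` H \<subseteq> A" for A
  proof
    fix f assume "f \<in> carrier T"
    then show "f \<in> A"
      using group_ring_induct[OF gen, of A H f] A(2) additive_subgroup.zero_closed[OF A(1)]
        additive_subgroup.a_closed[OF A(1)] by (auto simp: T_simps Tc)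
  qed
  have finT: "finite (carrier T)"
    using finite_supported[OF fin finH] by (simp add: T_def)
  have "a \<in> carrier T" using a by (auto simp: Tc H_def generate.incl)
  then have "\<exists>u\<in>Units T. a = a \<otimes>\<^bsub>T\<^esub> u \<otimes>\<^bsub>T\<^esub> a"
    using T.finite_regular_imp_unit_regular[OF finT]
      T.averaging_imp_regular[OF finT n(1) T_char \<delta>H cop_card span] by blast
  \<comment> \<open>\<open>T\<close> and \<open>S\<close> share multiplication and identity, so an
    inverse in \<open>T\<close> is one in \<open>S\<close>.\<close>
  moreover have "Units T \<subseteq> Units S" by (auto simp: Units_def T_simps Tc)
  ultimately show "\<exists>u\<in>Units S. a = a \<otimes>\<^bsub>S\<^esub> u \<otimes>\<^bsub>S\<^esub> a" by (auto simp: T_simps)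
qed

end

section \<open>Residue rings as coefficients\<close>

text \<open>Distinct primes are pairwise coprime, which makes their product squarefree; conversely
  all prime multiplicities of a squarefree number are 1. Positivity settles the sign that prime
  factors leave open.\<close>

lemma product_of_distinct_primes_iff_squarefree:
  assumes "n > 0"
  shows "product_of_distinct_primes n \<longleftrightarrow> squarefree n"
proof
  assume "product_of_distinct_primes n"
  then obtain P where P: "\<forall>p\<in>P. prime p" "n = \<Prod>P"
    unfolding product_of_distinct_primes_def by blast
  have "squarefree (\<Prod>P)"
    using P(1) by (intro squarefree_prod_coprime) (auto intro: primes_coprime squarefree_prime)
  then show "squarefree n" using P(2) by simp
next
  assume sq: "squarefree n"
  have "n = (\<Prod>p\<in>prime_factors n. p ^ multiplicity p n)"
    using assms prod_prime_factors[of n] by simp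
  also have "\<dots> = \<Prod>(prime_factors n)"
    using sq assms squarefree_factorial_semiring'[of n] by (intro prod.cong) auto
  finally show "product_of_distinct_primes n"
    unfolding product_of_distinct_primes_def
    by (intro exI[of _ "prime_factors n"]) auto
qed

lemma squarefree_nat_iff:
  assumes "n > 0"
  shows "squarefree (nat n) \<longleftrightarrow> squarefree n"
proof
  assume n: "squarefree n"
  show "squarefree (nat n)"
  proof (rule squarefreeI)
    fix x :: nat assume "x ^ 2 dvd nat n"
    then have "int (x ^ 2) dvd n" using assms by (simp add: int_dvd_int_iff[symmetric])
    then show "x dvd 1" using squarefreeD[OF n, of "int x"] by simp
  qed
next
  assume n: "squarefree (nat n)"
  show "squarefree n"
  proof (rule squarefreeI)
    fix x :: int assume "x ^ 2 dvd n"
    then have "nat \<bar>x\<bar> ^ 2 dvd nat n"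
      using assms by (simp add: int_dvd_int_iff[symmetric])
    then show "x dvd 1" using squarefreeD[OF n, of "nat \<bar>x\<bar>"] by simp
  qed
qed

lemma residue_ring_add_pow:
  assumes "n > 1" "r \<in> carrier (residue_ring n)"
  shows "[(k::nat)] \<cdot>\<^bsub>residue_ring n\<^esub> r = (int k * r) mod n"
proof -
  interpret residues n "residue_ring n" using assms(1) by unfold_locales simp
  show ?thesis
  proof (induction k)
    case (Suc k)
    have "[Suc k] \<cdot>\<^bsub>residue_ring n\<^esub> r = [k] \<cdot>\<^bsub>residue_ring n\<^esub> r \<oplus>\<^bsub>residue_ring n\<^esub> r"
      by simp
    then show ?case using Suc by (simp add: res_add_eq algebra_simps mod_simps)
  qed (simp add: res_zero_eq)
qed

text \<open>If \<open>n = d^2 * k\<close>, then \<open>dk\<close> squares to zero modulo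
  \<open>n\<close>. Regularity gives \<open>dk = dk * s * dk\<close>, so \<open>dk\<close> itself is
  zero modulo \<open>n\<close>.\<close>

lemma regular_residue_ring_imp_squarefree:
  assumes n: "n > 1"
    and reg: "\<And>r. r \<in> carrier (residue_ring n) \<Longrightarrow>
      \<exists>s\<in>carrier (residue_ring n). r = r \<otimes>\<^bsub>residue_ring n\<^esub> s \<otimes>\<^bsub>residue_ring n\<^esub> r"
  shows "squarefree n"
proof (rule squarefreeI)
  interpret residues n "residue_ring n" using n by unfold_locales simp
  fix d assume "d ^ 2 dvd n"
  then obtain k where k: "n = d ^ 2 * k" by (rule dvdE)
  obtain s where "(d * k) mod n = ((d * k) mod n * s) mod n * ((d * k) mod n) mod n"
    using reg[of "(d * k) mod n"] by (auto simp: res_mult_eq mod_in_carrier)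
  also have "\<dots> = (n * (k * s)) mod n"
    by (simp add: mod_simps) (simp add: k power2_eq_square mult_ac)
  finally have "n dvd d * k" by (simp add: dvd_eq_mod_eq_0)
  \<comment> \<open>Now \<open>d^2 * k\<close> divides the nonzero number \<open>dk\<close>;
    cancelling \<open>dk\<close> makes \<open>d\<close> a unit.\<close>
  then obtain l where "d * k = d ^ 2 * k * l" unfolding k by (rule dvdE)
  moreover have "d * k \<noteq> 0" using k n by auto
  ultimately have "d * l = 1" by (simp add: power2_eq_square)
  then show "d dvd 1" by (metis dvd_triv_left)
qed

theorem theorem4p5:
  fixes n :: int and G :: "('g, 'k) monoid_scheme"
  assumes "n > 1" and "group G"
  shows "unit_regular_ring (group_ring (residue_ring n) G) \<longleftrightarrow>
    product_of_distinct_primes n \<and> locally_finite_group G \<and>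
    (\<forall>x\<in>carrier G. coprime (int (group.ord G x)) n)"
proof -
  interpret R: residues n "residue_ring n" using assms(1) by unfold_locales simp
  interpret group_and_ring G "residue_ring n"
    using assms(2) R.ring_axioms by (rule group_and_ring.intro)
  have n0: "n > 0" using assms(1) by simp
  have nontriv: "\<one>\<^bsub>residue_ring n\<^esub> \<noteq> \<zero>\<^bsub>residue_ring n\<^esub>"
    by (simp add: R.res_one_eq R.res_zero_eq)
  show ?thesis
  proof
    assume "unit_regular_ring (group_ring (residue_ring n) G)"
    then have reg: "\<exists>b\<in>carrier S. a = a \<otimes>\<^bsub>S\<^esub> b \<otimes>\<^bsub>S\<^esub> a" if "a \<in> carrier S" for a
      using that unit_regular_ring.unit_regular S.Units_closed by metis
    have "product_of_distinct_primes n"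
      using regular_residue_ring_imp_squarefree[OF assms(1) regular_coefficient_ring[OF reg]]
        product_of_distinct_primes_iff_squarefree[OF n0] by blast
    moreover have lf: "locally_finite_group G"
      by unfold_locales (rule regular_imp_finite_and_invertible_card(1)[OF reg nontriv])
    moreover have "coprime (int (G.ord x)) n" if x: "x \<in> carrier G" for x
    proof -
      \<comment> \<open>Taking the one-element set \<open>{x}\<close> as \<open>A\<close> makes the
        order of \<open>x\<close> invertible in the residue ring, that is, prime to
        \<open>n\<close>.\<close>
      have "G.ord x = card (generate G {x})" by (rule G.generate_pow_card[OF x])
      then obtain r where r: "r \<in> carrier (residue_ring n)" "[G.ord x] \<cdot>\<^bsub>residue_ring n\<^esub> r = 1"
        using regular_imp_finite_and_invertible_card(2)[OF reg nontriv, of "{x}"] x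
        by (auto simp: R.res_one_eq)
      then have "[int (G.ord x) * r = 1] (mod n)"
        using assms(1) by (simp add: residue_ring_add_pow cong_def)
      then show ?thesis using coprime_iff_invertible_int by blast
    qed
    ultimately show "product_of_distinct_primes n \<and> locally_finite_group G \<and>
      (\<forall>x\<in>carrier G. coprime (int (G.ord x)) n)" by blast
  next
    assume *: "product_of_distinct_primes n \<and> locally_finite_group G \<and>
      (\<forall>x\<in>carrier G. coprime (int (G.ord x)) n)"
    show "unit_regular_ring (group_ring (residue_ring n) G)"
    proof (rule unit_regular_group_ring[of "nat n"])
      \<comment> \<open>Each residue is the multiple of 1 by its own representative between 0 and
        \<open>n - 1\<close>.\<close>
      show "\<exists>k::nat. r = [k] \<cdot>\<^bsub>residue_ring n\<^esub> \<one>\<^bsub>residue_ring n\<^esub>"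
        if "r \<in> carrier (residue_ring n)" for r
        using that assms(1) by (intro exI[of _ "nat r"])
          (simp add: residue_ring_add_pow R.res_carrier_eq R.res_one_eq)
      show "squarefree (nat n)"
        using * product_of_distinct_primes_iff_squarefree[OF n0] squarefree_nat_iff[OF n0] by blast
      show "[nat n] \<cdot>\<^bsub>residue_ring n\<^esub> \<one>\<^bsub>residue_ring n\<^esub> = \<zero>\<^bsub>residue_ring n\<^esub>"
        using assms(1) by (simp add: residue_ring_add_pow R.res_one_eq R.res_carrier_eq R.res_zero_eq)
      show "coprime (G.ord x) (nat n)" if "x \<in> carrier G" for x
        using * that n0 by (simp flip: coprime_int_iff)
    qed (use * nontriv in auto)
  qed
qed

end
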